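(* Let $\Phi$ be an irreducible affine reflection system whose underlying finite root system $\mathring{\Phi}$ is of type $F_4$. A subset $\Psi\subseteq\Phi$ is a maximal closed subroot system with semi-closed gradient if and only if there exist a maximal subgroup $H\subseteq\Lambda_s$ of index $2$ containing $\Lambda_\ell$, a subset $I\subseteq\{1,2,3,4\}$ of cardinality two, and a $\mathbb{Z}$-linear function $\tau:\mathring{\Phi}_s\to\Lambda_s/H$ satisfying $$\tau(\epsilon_i)=\tau(\epsilon_j)\ \text{ if } i,j\in I \text{ or } i,j\notin I,\qquad \tau(\epsilon_r)\neq\tau(\epsilon_s)\ \text{ for } r\in I,\ s\notin I,$$ such that $$\Psi=\{\alpha\oplus\tau(\alpha):\alpha\in\mathring{\Phi}_s\}\cup\{(\pm\epsilon_i\pm\epsilon_j)\oplus\Lambda_\ell: i\neq j,\ i,j\in I\text{ or } i,j\notin I\}.$$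
   Context: Finite root systems: $V$ is a finite-dimensional real Euclidean space with inner product $(\cdot,\cdot)$. A finite root system $\mathring{\Phi}\subset V$ is a finite spanning set with $0\notin\mathring{\Phi}$, $s_\alpha(\mathring{\Phi})=\mathring{\Phi}$ and $(\beta,\alpha^\vee)\in\mathbb{Z}$ for all $\alpha,\beta\in\mathring{\Phi}$, where $\alpha^\vee=2\alpha/(\alpha,\alpha)$ and $s_\alpha(v)=v-(v,\alpha^\vee)\alpha$. $\mathring{\Phi}_s$ and $\mathring{\Phi}_\ell$ are the sets of short and long roots. The root system $F_4$ is realized in $\mathbb{R}^4$ with orthonormal basis $\epsilon_1,\dots,\epsilon_4$: $\mathring{\Phi}_s=\{\pm\epsilon_i\}\cup\{\tfrac12(\pm\epsilon_1\pm\epsilon_2\pm\epsilon_3\pm\epsilon_4)\}$, $\mathring{\Phi}_\ell=\{\pm\epsilon_i\pm\epsilon_j:i\ne j\}$ (all signs independent). Extension datum (for reduced $\mathring{\Phi}$): a family $(\Lambda_\alpha)_{\alpha\in\mathring{\Phi}\cup\{0\}}$ of subsets of a finite-dimensional real vector space $Y$ such that (1) $\Lambda_\beta-(\beta,\alpha^\vee)\Lambda_\alpha\subseteq\Lambda_{s_\alpha(\beta)}$ for all $\alpha,\beta\in\mathring{\Phi}$; (2) $0\in\Lambda_\alpha$ for all $\alpha\in\mathring{\Phi}\cup\{0\}$; (3) $Y$ is the real span of $\bigcup_\alpha\Lambda_\alpha$. For $\mathring{\Phi}$ irreducible, $\Lambda_\alpha$ ($\alpha\in\mathring{\Phi}$)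 depends only on the length of $\alpha$; the common values on short and long roots are denoted $\Lambda_s$ and $\Lambda_\ell$. For type $F_4$, both are subgroups of $Y$ and $2\Lambda_s\subseteq\Lambda_\ell\subseteq\Lambda_s$. Affine reflection system: up to isomorphism, every affine reflection system is $\Phi=\bigcup_{\alpha\in\mathring{\Phi}\cup\{0\}}\alpha\oplus\Lambda_\alpha\subset X=V\oplus Y$ with form $(v_1\oplus y_1,v_2\oplus y_2)_X=(v_1,v_2)$, for a finite root system $\mathring{\Phi}$ and an extension datum; it is irreducible iff $\mathring{\Phi}$ is. Here $\alpha\oplus S=\{\alpha\oplus y:y\in S\}$ for a subset $S\subseteq Y$ (in particular for a coset $S$), and displayed sets of such expressions denote their unions. The real roots are $\Phi^{\mathrm{re}}=\bigcup_{\alpha\in\mathring{\Phi}}\alpha\oplus\Lambda_\alpha$, and $s_{\alpha\oplus y}(\beta\oplus z)=s_\alpha(\beta)\oplus(z-(\beta,\alpha^\vee)y)$. Subroot systems: a proper non-empty subset $\Psi\subsetneq\Phi^{\mathrm{re}}$ is a subroot system if $s_a(b)\in\Psi$ for all $a,b\in\Psi$; it is closed if $a,b\in\Psi$ and $a+b\in\Phi^{\mathrm{re}}$ imply $a+b\in\Psi$; it is a maximal closed subroot system if it is a closed subroot system and there is no closed subroot system $\Psi'$ with $\Psi\subsetneq\Psi'\subsetneq\Phi^{\mathrm{re}}$. The gradient is $\mathrm{Gr}(\Psi)=\{\alpha\in\mathring{\Phi}:\exists y\in\Lambda_\alpha,\ \alpha\oplus y\in\Psi\}$. Semi-closed: a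 reflection-stable subset $\mathring{\Phi}'\subseteq\mathring{\Phi}$ is closed if $\alpha,\beta\in\mathring{\Phi}'$, $\alpha+\beta\in\mathring{\Phi}$ imply $\alpha+\beta\in\mathring{\Phi}'$; it is semi-closed if it is not closed and whenever $\alpha,\beta\in\mathring{\Phi}'$ with $\alpha+\beta\in\mathring{\Phi}\setminus\mathring{\Phi}'$ one has $\alpha,\beta\in\mathring{\Phi}_s$ and $\alpha+\beta\in\mathring{\Phi}_\ell$. $\mathbb{Z}$-linear: a function from a root system to an abelian group is $\mathbb{Z}$-linear if it is the restriction of a group homomorphism defined on the $\mathbb{Z}$-span of the root system. *)

theory Defs
  imports
    "HOL-Analysis.Analysis"
    "HOL-Algebra.Coset"
    "HOL-Computational_Algebra.Group_Closure"
begin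

section \<open>Finite root systems\<close>

definition coroot :: "'v::euclidean_space \<Rightarrow> 'v" where
  "coroot \<alpha> = (2 / (\<alpha> \<bullet> \<alpha>)) *\<^sub>R \<alpha>"

definition refl_root :: "'v::euclidean_space \<Rightarrow> 'v \<Rightarrow> 'v" where
  "refl_root \<alpha> v = v - (v \<bullet> coroot \<alpha>) *\<^sub>R \<alpha>"

definition finite_root_system :: "'v::euclidean_space set \<Rightarrow> bool" where
  "finite_root_system R \<longleftrightarrow>
     finite R \<and> span R = UNIV \<and> 0 \<notin> R \<and>
     (\<forall>\<alpha>\<in>R. refl_root \<alpha> ` R = R) \<and>
     (\<forall>\<alpha>\<in>R. \<forall>\<beta>\<in>R. \<beta> \<bullet> coroot \<alpha> \<in> \<int>)"

definition irreducible_root_system :: "'v::euclidean_space set \<Rightarrow> bool" where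
  "irreducible_root_system R \<longleftrightarrow>
     finite_root_system R \<and>
     \<not> (\<exists>A B. A \<noteq> {} \<and> B \<noteq> {} \<and> A \<inter> B = {} \<and> R = A \<union> B \<and>
            (\<forall>\<alpha>\<in>A. \<forall>\<beta>\<in>B. \<alpha> \<bullet> \<beta> = 0))"

text \<open>
  The next two sets are the usual ones when \<open>R\<close> is irreducible, reduced and not simply laced
  (so that exactly two root lengths occur), which is the only case used here.
\<close>

definition short_roots :: "'v::euclidean_space set \<Rightarrow> 'v set" where
  "short_roots R = {\<alpha>\<in>R. \<forall>\<beta>\<in>R. norm \<alpha> \<le> norm \<beta>}"

definition long_roots :: "'v::euclidean_space set \<Rightarrow> 'v set" where
  "long_roots R = {\<alpha>\<in>R. \<forall>\<beta>\<in>R. norm \<beta> \<le> norm \<alpha>}"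

definition reflection_stable :: "'v::euclidean_space set \<Rightarrow> bool" where
  "reflection_stable S \<longleftrightarrow> (\<forall>\<alpha>\<in>S. \<forall>\<beta>\<in>S. refl_root \<alpha> \<beta> \<in> S)"

definition sum_closed_in :: "'a::plus set \<Rightarrow> 'a set \<Rightarrow> bool" where
  "sum_closed_in R S \<longleftrightarrow> (\<forall>a\<in>S. \<forall>b\<in>S. a + b \<in> R \<longrightarrow> a + b \<in> S)"

definition semi_closed :: "'v::euclidean_space set \<Rightarrow> 'v set \<Rightarrow> bool" where
  "semi_closed R S \<longleftrightarrow>
     S \<subseteq> R \<and> reflection_stable S \<and> \<not> sum_closed_in R S \<and>
     (\<forall>\<alpha>\<in>S. \<forall>\<beta>\<in>S. \<alpha> + \<beta> \<in> R - S \<longrightarrow>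
        \<alpha> \<in> short_roots R \<and> \<beta> \<in> short_roots R \<and> \<alpha> + \<beta> \<in> long_roots R)"


section \<open>Affine reflection systems\<close>

text \<open>
  This is the notion of extension datum for reduced \<open>R\<close>; for non-reduced \<open>R\<close> further axioms
  would be needed. \<open>Y\<close> is a finite-dimensional subspace of the ambient type (possibly \<open>{0}\<close>).
  Only the values of \<open>\<Lambda>\<close> on \<open>insert 0 R\<close> matter.
\<close>

definition extension_datum ::
    "'v::euclidean_space set \<Rightarrow> 'y::real_vector set \<Rightarrow> ('v \<Rightarrow> 'y set) \<Rightarrow> bool" where
  "extension_datum R Y \<Lambda> \<longleftrightarrow>
     (\<exists>B. finite B \<and> span B = Y) \<and>
     (\<forall>\<alpha>\<in>R. \<forall>\<beta>\<in>R. \<forall>y\<in>\<Lambda> \<beta>. \<forall>z\<in>\<Lambda> \<alpha>.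
        y - (\<beta> \<bullet> coroot \<alpha>) *\<^sub>R z \<in> \<Lambda> (refl_root \<alpha> \<beta>)) \<and>
     (\<forall>\<alpha>\<in>insert 0 R. 0 \<in> \<Lambda> \<alpha>) \<and>
     span (\<Union>\<alpha>\<in>insert 0 R. \<Lambda> \<alpha>) = Y"

text \<open>The element \<open>\<alpha> \<oplus> y\<close> of \<open>V \<oplus> Y\<close> is the pair \<open>(\<alpha>, y)\<close>.\<close>

definition irreducible_affine_reflection_system ::
    "'v::euclidean_space set \<Rightarrow> 'y::real_vector set \<Rightarrow> ('v \<Rightarrow> 'y set) \<Rightarrow> ('v \<times> 'y) set \<Rightarrow> bool" where
  "irreducible_affine_reflection_system R Y \<Lambda> \<Phi> \<longleftrightarrow>
     irreducible_root_system R \<and> extension_datum R Y \<Lambda> \<and>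
     \<Phi> = (\<Union>\<alpha>\<in>insert 0 R. {\<alpha>} \<times> \<Lambda> \<alpha>)"

definition real_roots :: "'v::euclidean_space set \<Rightarrow> ('v \<Rightarrow> 'y::real_vector set) \<Rightarrow> ('v \<times> 'y) set" where
  "real_roots R \<Lambda> = (\<Union>\<alpha>\<in>R. {\<alpha>} \<times> \<Lambda> \<alpha>)"

definition affine_refl ::
    "'v::euclidean_space \<times> 'y::real_vector \<Rightarrow> 'v \<times> 'y \<Rightarrow> 'v \<times> 'y" where
  "affine_refl a b =
     (refl_root (fst a) (fst b), snd b - (fst b \<bullet> coroot (fst a)) *\<^sub>R snd a)"

text \<open>In the following three definitions, \<open>P\<close> is the set of real roots.\<close>

definition subroot_system :: "('v::euclidean_space \<times> 'y::real_vector) set \<Rightarrow> ('v \<times> 'y) set \<Rightarrow> bool" where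
  "subroot_system P \<Psi> \<longleftrightarrow>
     \<Psi> \<noteq> {} \<and> \<Psi> \<subset> P \<and> (\<forall>a\<in>\<Psi>. \<forall>b\<in>\<Psi>. affine_refl a b \<in> \<Psi>)"

definition closed_subroot_system :: "('v::euclidean_space \<times> 'y::real_vector) set \<Rightarrow> ('v \<times> 'y) set \<Rightarrow> bool" where
  "closed_subroot_system P \<Psi> \<longleftrightarrow> subroot_system P \<Psi> \<and> sum_closed_in P \<Psi>"

definition maximal_closed_subroot_system ::
    "('v::euclidean_space \<times> 'y::real_vector) set \<Rightarrow> ('v \<times> 'y) set \<Rightarrow> bool" where
  "maximal_closed_subroot_system P \<Psi> \<longleftrightarrow>
     closed_subroot_system P \<Psi> \<and>
     \<not> (\<exists>\<Psi>'. closed_subroot_system P \<Psi>' \<and> \<Psi> \<subset> \<Psi>' \<and> \<Psi>' \<subset> P)"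

definition gradient ::
    "'v::euclidean_space set \<Rightarrow> ('v \<Rightarrow> 'y::real_vector set) \<Rightarrow> ('v \<times> 'y) set \<Rightarrow> 'v set" where
  "gradient R \<Lambda> \<Psi> = {\<alpha>\<in>R. \<exists>y\<in>\<Lambda> \<alpha>. (\<alpha>, y) \<in> \<Psi>}"

text \<open>
  The common values of \<open>\<Lambda>\<close> on the short and on the long roots. That they exist for the
  root system below is proved as \<open>Lambda_short_eq\<close> and \<open>Lambda_long_eq\<close>.
\<close>

definition Lambda_short :: "'v::euclidean_space set \<Rightarrow> ('v \<Rightarrow> 'y set) \<Rightarrow> 'y set" where
  "Lambda_short R \<Lambda> = (THE L. \<forall>\<alpha>\<in>short_roots R. \<Lambda> \<alpha> = L)"

definition Lambda_long :: "'v::euclidean_space set \<Rightarrow> ('v \<Rightarrow> 'y set) \<Rightarrow> 'y set" where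
  "Lambda_long R \<Lambda> = (THE L. \<forall>\<alpha>\<in>long_roots R. \<Lambda> \<alpha> = L)"


section \<open>Additive subgroups and \<open>\<int>\<close>-linear functions\<close>

text \<open>
  An additive subgroup of the ambient type, viewed as a group in the sense of HOL-Algebra.
\<close>

definition additive_grp :: "'a::ab_group_add set \<Rightarrow> 'a monoid" where
  "additive_grp S = \<lparr>carrier = S, monoid.mult = (+), one = 0\<rparr>"

definition maximal_subgroup :: "'a set \<Rightarrow> 'a monoid \<Rightarrow> bool" where
  "maximal_subgroup H G \<longleftrightarrow>
     subgroup H G \<and> H \<noteq> carrier G \<and>
     (\<forall>K. subgroup K G \<and> H \<subseteq> K \<longrightarrow> K = H \<or> K = carrier G)"

definition subgroup_index :: "'a monoid \<Rightarrow> 'a set \<Rightarrow> nat" where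
  "subgroup_index G H = card (rcosets\<^bsub>G\<^esub> H)"

text \<open>The \<open>\<int>\<close>-span of \<open>R\<close> is \<open>group_closure R\<close>.\<close>

definition Z_linear :: "'v::ab_group_add set \<Rightarrow> 'b monoid \<Rightarrow> ('v \<Rightarrow> 'b) \<Rightarrow> bool" where
  "Z_linear R A \<tau> \<longleftrightarrow>
     (\<exists>f \<in> hom (additive_grp (group_closure R)) A. \<forall>\<alpha>\<in>R. \<tau> \<alpha> = f \<alpha>)"


section \<open>The root system \<open>F\<^sub>4\<close>\<close>

text \<open>The index type \<open>4\<close> has the elements \<open>1, 2, 3, 4\<close>, with \<open>4 = 0\<close>.\<close>

definition \<epsilon> :: "4 \<Rightarrow> real^4" where
  "\<epsilon> i = axis i 1"

definition F4_short :: "(real^4) set" where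
  "F4_short =
     {c *\<^sub>R \<epsilon> i | c i. c \<in> {1, -1}} \<union>
     {(1/2) *\<^sub>R (\<Sum>i\<in>UNIV. c i *\<^sub>R \<epsilon> i) | c. \<forall>i. c i \<in> {1, -1}}"

definition F4_long :: "(real^4) set" where
  "F4_long = {c *\<^sub>R \<epsilon> i + d *\<^sub>R \<epsilon> j | c d i j. c \<in> {1, -1} \<and> d \<in> {1, -1} \<and> i \<noteq> j}"

definition F4 :: "(real^4) set" where
  "F4 = F4_short \<union> F4_long"


subsection \<open>Sanity checks\<close>

lemma eps_nth: "\<epsilon> i $ j = (if i = j then 1 else 0)"
  by (auto simp: \<epsilon>_def axis_def)

lemma neq4: "(1::4) \<noteq> 2" "(1::4) \<noteq> 3" "(1::4) \<noteq> 4" "(2::4) \<noteq> 3" "(2::4) \<noteq> 4" "(3::4) \<noteq> 4"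
  by simp_all

lemma inner4: "(v::real^4) \<bullet> w = v$1*w$1 + v$2*w$2 + v$3*w$3 + v$4*w$4"
  by (simp add: inner_vec_def sum_4)

text \<open>Membership in the lattice spanned by \<open>\<epsilon> i\<close> and half the sum of all \<open>\<epsilon> i\<close>.\<close>

definition in_lat :: "real^4 \<Rightarrow> bool" where
  "in_lat v \<longleftrightarrow> (\<exists>(p::int) (b::int) (c::int) (d::int). v$1 = p/2 \<and> v$2 = p/2 + b \<and> v$3 = p/2 + c \<and> v$4 = p/2 + d)"

lemma in_latI:
  "v$1 = real_of_int p/2 \<Longrightarrow> v$2 = p/2 + real_of_int b \<Longrightarrow> v$3 = p/2 + real_of_int c \<Longrightarrow>
   v$4 = p/2 + real_of_int d \<Longrightarrow> in_lat v"
  unfolding in_lat_def by blast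

lemma in_lat_diff_int:
  assumes "in_lat v" "in_lat w" "n \<in> \<int>"
  shows "in_lat (v - n *\<^sub>R w)"
proof -
  obtain p b c d p' b' c' d' k :: int where
    "v$1 = p/2" "v$2 = p/2 + b" "v$3 = p/2 + c" "v$4 = p/2 + d"
    "w$1 = p'/2" "w$2 = p'/2 + b'" "w$3 = p'/2 + c'" "w$4 = p'/2 + d'" "n = k"
    using assms unfolding in_lat_def by (elim exE conjE Ints_cases) blast
  then show ?thesis
    by (intro in_latI[where p="p-k*p'" and b="b-k*b'" and c="c-k*c'" and d="d-k*d'"])
       (auto simp: field_simps)
qed

lemma small_int_cases:
  fixes a :: int assumes "a\<^sup>2 \<le> 2" shows "a = -1 \<or> a = 0 \<or> a = 1"
proof -
  have "\<bar>a\<bar> < 2"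
  proof (rule ccontr)
    assume "\<not> \<bar>a\<bar> < 2"
    then have "2\<^sup>2 \<le> \<bar>a\<bar>\<^sup>2" by (intro power_mono) auto
    with assms show False by simp
  qed
  then show ?thesis by linarith
qed

lemma lat_norm_int:
  fixes v :: "real^4"
  assumes "v$1 = real_of_int p/2" "v$2 = p/2 + real_of_int b" "v$3 = p/2 + real_of_int c"
    "v$4 = p/2 + real_of_int d" "v \<bullet> v = real_of_int N"
  shows "p\<^sup>2 + p*(b+c+d) + (b\<^sup>2+c\<^sup>2+d\<^sup>2) = N"
proof -
  have "real_of_int (p\<^sup>2 + p*(b+c+d) + (b\<^sup>2+c\<^sup>2+d\<^sup>2)) = real_of_int N"
    unfolding assms(5)[symmetric] inner4 assms(1-4) by (simp add: power2_eq_square field_simps)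
  then show ?thesis by (simp only: of_int_eq_iff)
qed

lemma F4_shortI:
  "c \<in> {1, -1} \<Longrightarrow> v = c *\<^sub>R \<epsilon> i \<Longrightarrow> v \<in> F4_short"
  "(\<And>i. v $ i = 1/2 \<or> v $ i = -1/2) \<Longrightarrow> v \<in> F4_short"
proof -
  show "c \<in> {1, -1} \<Longrightarrow> v = c *\<^sub>R \<epsilon> i \<Longrightarrow> v \<in> F4_short"
    unfolding F4_short_def by blast
next
  assume *: "\<And>i. v $ i = 1/2 \<or> v $ i = -1/2"
  have "v = (1/2) *\<^sub>R (\<Sum>i\<in>UNIV. (2 * v$i) *\<^sub>R \<epsilon> i)"
    by (simp add: vec_eq_iff forall_4 sum_4 eps_nth)
  moreover have "2 * v$i \<in> {1, -1}" for i
    using *[of i] by auto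
  ultimately show "v \<in> F4_short"
    unfolding F4_short_def by (intro UnI2 CollectI exI[of _ "\<lambda>i. 2 * v$i"]) blast
qed

lemma F4_longI:
  "c \<in> {1, -1} \<Longrightarrow> d \<in> {1, -1} \<Longrightarrow> i \<noteq> j \<Longrightarrow> v = c *\<^sub>R \<epsilon> i + d *\<^sub>R \<epsilon> j \<Longrightarrow> v \<in> F4_long"
  unfolding F4_long_def by blast

lemma F4_short_iff: "v \<in> F4_short \<longleftrightarrow> in_lat v \<and> v \<bullet> v = 1"
proof
  assume "v \<in> F4_short"
  then consider (e) c i where "c \<in> {1,-1}" "v = c *\<^sub>R \<epsilon> i"
    | (h) c where "\<forall>i. c i \<in> {1,-1::real}" "v = (1/2) *\<^sub>R (\<Sum>i\<in>UNIV. c i *\<^sub>R \<epsilon> i)"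
    unfolding F4_short_def by blast
  then show "in_lat v \<and> v \<bullet> v = 1"
  proof cases
    case e
    obtain k :: int where k: "c = real_of_int k" "k = 1 \<or> k = -1"
      using e(1) by (metis insertE empty_iff of_int_1 of_int_minus)
    have n: "v$j = (if i = j then k else 0)" for j
      using e k by (simp add: eps_nth)
    show ?thesis
    proof
      show "in_lat v"
        by (rule in_latI[where p="2*(if i = 1 then k else 0)"
              and b="(if i = 2 then k else 0) - (if i = 1 then k else 0)"
              and c="(if i = 3 then k else 0) - (if i = 1 then k else 0)"
              and d="(if i = 4 then k else 0) - (if i = 1 then k else 0)"])
           (simp_all add: n)
      show "v \<bullet> v = 1"
        using k(2) exhaust_4[of i] by (auto simp: inner4 n)
    qed
  next
    case h
    have n: "v$j = c j / 2" for j
      using h(2) exhaust_4[of j] by (auto simp: sum_4 eps_nth)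
    have "\<forall>i. \<exists>k::int. c i = real_of_int k \<and> (k = 1 \<or> k = -1)"
      using h(1) by (metis insertE empty_iff of_int_1 of_int_minus)
    then obtain k :: "4 \<Rightarrow> int" where k: "c i = k i" "k i = 1 \<or> k i = -1" for i
      by metis
    have n': "v$j = k j / 2" for j by (simp add: n k)
    have ev: "2 * real_of_int ((k i - k j) div 2) = k i - k j" for i j
      using k(2)[of i] k(2)[of j] by auto
    show ?thesis
    proof
      show "in_lat v"
        by (rule in_latI[where p="k 1" and b="(k 2 - k 1) div 2" and c="(k 3 - k 1) div 2"
              and d="(k 4 - k 1) div 2"])
           (use ev[of 2 1] ev[of 3 1] ev[of 4 1] in \<open>simp_all add: n'\<close>)
      have "v $ j * v $ j = 1/4" for j using k(2)[of j] by (auto simp: n')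
      from this[of 1] this[of 2] this[of 3] this[of 4] show "v \<bullet> v = 1" by (simp add: inner4)
    qed
  qed
next
  assume *: "in_lat v \<and> v \<bullet> v = 1"
  then obtain p b c d :: int where
    v: "v$1 = p/2" "v$2 = p/2 + b" "v$3 = p/2 + c" "v$4 = p/2 + d"
    unfolding in_lat_def by blast
  have N: "p\<^sup>2 + p*(b+c+d) + (b\<^sup>2+c\<^sup>2+d\<^sup>2) = 1"
    using lat_norm_int[OF v, of 1] * by simp
  show "v \<in> F4_short"
  proof (cases "even p")
    case True
    then obtain a where a: "p = 2*a" by blast
    have s: "a\<^sup>2 + (a+b)\<^sup>2 + (a+c)\<^sup>2 + (a+d)\<^sup>2 = 1"
      using N a by (simp add: power2_eq_square algebra_simps)
    have nn: "0 \<le> a\<^sup>2" "0 \<le> (a+b)\<^sup>2" "0 \<le> (a+c)\<^sup>2" "0 \<le> (a+d)\<^sup>2" by simp_all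
    define x y z where "x = a+b" "y = a+c" "z = a+d"
    have cs: "a = -1 \<or> a = 0 \<or> a = 1" "x = -1 \<or> x = 0 \<or> x = 1"
      "y = -1 \<or> y = 0 \<or> y = 1" "z = -1 \<or> z = 0 \<or> z = 1"
      unfolding x_y_z_def by (rule small_int_cases; use s nn in linarith)+
    have v': "v$1 = a" "v$2 = x" "v$3 = y" "v$4 = z"
      using v a x_y_z_def by simp_all
    have s': "a\<^sup>2 + x\<^sup>2 + y\<^sup>2 + z\<^sup>2 = 1" using s x_y_z_def by simp
    have "\<exists>c i. c \<in> {1,-1} \<and> v = c *\<^sub>R \<epsilon> i"
    proof -
      have "v = (of_int a) *\<^sub>R \<epsilon> 1 \<and> a \<in> {1,-1} \<or> v = (of_int x) *\<^sub>R \<epsilon> 2 \<and> x \<in> {1,-1} \<or>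
            v = (of_int y) *\<^sub>R \<epsilon> 3 \<and> y \<in> {1,-1} \<or> v = (of_int z) *\<^sub>R \<epsilon> 4 \<and> z \<in> {1,-1}"
        unfolding vec_eq_iff forall_4 using cs s' by (elim disjE; simp add: v' eps_nth)
      then show ?thesis by fastforce
    qed
    then show ?thesis using F4_shortI(1) by blast
  next
    case False
    define x y z where "x = p+2*b" "y = p+2*c" "z = p+2*d"
    have s: "p\<^sup>2 + x\<^sup>2 + y\<^sup>2 + z\<^sup>2 = 4"
      using N by (simp add: x_y_z_def power2_eq_square algebra_simps)
    have o: "odd p" "odd x" "odd y" "odd z" using False x_y_z_def by simp_all
    have ge: "1 \<le> t\<^sup>2" if "odd t" for t :: int
    proof -
      have "t\<^sup>2 \<noteq> 0" using that by auto
      then show ?thesis using zero_le_power2[of t] by linarith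
    qed
    have "p\<^sup>2 = 1" "x\<^sup>2 = 1" "y\<^sup>2 = 1" "z\<^sup>2 = 1"
      using s ge[OF o(1)] ge[OF o(2)] ge[OF o(3)] ge[OF o(4)] by linarith+
    then have cs: "p = 1 \<or> p = -1" "x = 1 \<or> x = -1" "y = 1 \<or> y = -1" "z = 1 \<or> z = -1"
      by (simp_all add: power2_eq_1_iff)
    have v': "v$1 = p/2" "v$2 = x/2" "v$3 = y/2" "v$4 = z/2"
      using v x_y_z_def by (simp_all add: field_simps)
    have "\<forall>i. v $ i = 1/2 \<or> v $ i = -1/2"
      unfolding forall_4 using cs by (auto simp: v')
    then show ?thesis using F4_shortI(2) by blast
  qed
qed

lemma long_lat_even:
  fixes v :: "real^4"
  assumes "v$1 = real_of_int p/2" "v$2 = p/2 + real_of_int b" "v$3 = p/2 + real_of_int c"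
    "v$4 = p/2 + real_of_int d" "v \<bullet> v = 2"
  shows "even p" "even (b + c + d)"
proof -
  have N: "p\<^sup>2 + p*(b+c+d) + (b\<^sup>2+c\<^sup>2+d\<^sup>2) = 2"
    using lat_norm_int[OF assms(1-4), of 2] assms(5) by simp
  then have ev: "even (p\<^sup>2 + p*(b+c+d) + (b\<^sup>2+c\<^sup>2+d\<^sup>2))" by simp
  then show p: "even p" by auto
  then show "even (b + c + d)" using ev by auto
qed

lemma F4_long_iff: "v \<in> F4_long \<longleftrightarrow> in_lat v \<and> v \<bullet> v = 2"
proof
  assume "v \<in> F4_long"
  then obtain c d i j where cd: "c \<in> {1,-1}" "d \<in> {1,-1}" "i \<noteq> j" "v = c *\<^sub>R \<epsilon> i + d *\<^sub>R \<epsilon> j"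
    unfolding F4_long_def by blast
  have "in_lat (c *\<^sub>R \<epsilon> i)" "in_lat (\<epsilon> j)"
    using F4_shortI(1)[of c] F4_shortI(1)[of 1 "\<epsilon> j" j] cd F4_short_iff by auto
  from in_lat_diff_int[OF this, of "-d"] have "in_lat v" using cd by auto
  moreover have "v \<bullet> v = 2"
    using cd exhaust_4[of i] exhaust_4[of j] by (auto simp: inner4 eps_nth)
  ultimately show "in_lat v \<and> v \<bullet> v = 2" by simp
next
  assume *: "in_lat v \<and> v \<bullet> v = 2"
  then obtain p b c d :: int where
    v: "v$1 = p/2" "v$2 = p/2 + b" "v$3 = p/2 + c" "v$4 = p/2 + d"
    unfolding in_lat_def by blast
  obtain a where a: "p = 2*a"
    using long_lat_even(1)[OF v] * by blast
  have N: "p\<^sup>2 + p*(b+c+d) + (b\<^sup>2+c\<^sup>2+d\<^sup>2) = 2"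
    using lat_norm_int[OF v, of 2] * by simp
  define x y z where "x = a+b" "y = a+c" "z = a+d"
  have s: "a\<^sup>2 + x\<^sup>2 + y\<^sup>2 + z\<^sup>2 = 2"
    using N a by (simp add: x_y_z_def power2_eq_square algebra_simps)
  have nn: "0 \<le> a\<^sup>2" "0 \<le> x\<^sup>2" "0 \<le> y\<^sup>2" "0 \<le> z\<^sup>2" by simp_all
  have cs: "a = -1 \<or> a = 0 \<or> a = 1" "x = -1 \<or> x = 0 \<or> x = 1"
    "y = -1 \<or> y = 0 \<or> y = 1" "z = -1 \<or> z = 0 \<or> z = 1"
    by (rule small_int_cases; use s nn in linarith)+
  have v': "v$1 = a" "v$2 = x" "v$3 = y" "v$4 = z"
    using v a x_y_z_def by simp_all
  let ?P = "\<lambda>c d i j. v = real_of_int c *\<^sub>R \<epsilon> i + real_of_int d *\<^sub>R \<epsilon> j \<and> c \<in> {1,-1} \<and> d \<in> {1,-1}"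
  have "?P a x 1 2 \<or> ?P a y 1 3 \<or> ?P a z 1 4 \<or> ?P x y 2 3 \<or> ?P x z 2 4 \<or> ?P y z 3 4"
    unfolding vec_eq_iff forall_4 using cs s by (elim disjE; simp add: v' eps_nth)
  moreover have "v \<in> F4_long" if "?P c d i j" "i \<noteq> j" for c d i j
    using that by (intro F4_longI[of "of_int c" "of_int d" i j]) auto
  ultimately show "v \<in> F4_long" using neq4 by metis
qed

lemma F4_iff: "v \<in> F4 \<longleftrightarrow> in_lat v \<and> (v \<bullet> v = 1 \<or> v \<bullet> v = 2)"
  by (auto simp: F4_def F4_short_iff F4_long_iff)

lemma eps_in_F4_short: "\<epsilon> i \<in> F4_short"
  using F4_shortI(1)[of 1 "\<epsilon> i" i] by simp

lemma F4_shortI': "v \<in> F4 \<Longrightarrow> v \<bullet> v = 1 \<Longrightarrow> v \<in> F4_short"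
  by (simp add: F4_iff F4_short_iff)

lemma short_roots_F4: "short_roots F4 = F4_short"
proof -
  have "v \<bullet> v = 1" if "v \<in> F4" "\<forall>\<beta>\<in>F4. norm v \<le> norm \<beta>" for v
  proof -
    have "norm v \<le> norm (\<epsilon> 1)" using that eps_in_F4_short F4_def by blast
    then have "v \<bullet> v \<le> 1" using eps_in_F4_short[of 1]
      by (simp add: norm_le F4_short_iff)
    then show ?thesis using that(1) by (auto simp: F4_iff)
  qed
  moreover have "norm v \<le> norm w" if "v \<in> F4_short" "w \<in> F4" for v w
    using that by (auto simp: F4_short_iff F4_iff norm_le)
  moreover have "F4_short \<subseteq> F4" by (simp add: F4_def)
  ultimately show ?thesis
    unfolding short_roots_def by (blast intro: F4_shortI')
qed

lemma F4_longI': "v \<in> F4 \<Longrightarrow> v \<bullet> v = 2 \<Longrightarrow> v \<in> F4_long"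
  by (simp add: F4_iff F4_long_iff)

lemma long_roots_F4: "long_roots F4 = F4_long"
proof -
  have e: "\<epsilon> 1 + \<epsilon> 2 \<in> F4_long"
    using F4_longI[of 1 1 1 2 "\<epsilon> 1 + \<epsilon> 2"] by simp
  have "v \<bullet> v = 2" if "v \<in> F4" "\<forall>\<beta>\<in>F4. norm \<beta> \<le> norm v" for v
  proof -
    have "norm (\<epsilon> 1 + \<epsilon> 2) \<le> norm v" using that e F4_def by blast
    then have "v \<bullet> v \<ge> 2" using e
      by (simp add: norm_le F4_long_iff)
    then show ?thesis using that(1) by (auto simp: F4_iff)
  qed
  moreover have "norm w \<le> norm v" if "v \<in> F4_long" "w \<in> F4" for v w
    using that by (auto simp: F4_long_iff F4_iff norm_le)
  moreover have "F4_long \<subseteq> F4" by (simp add: F4_def)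
  ultimately show ?thesis
    unfolding long_roots_def by (blast intro: F4_longI')
qed

lemma F4_integral:
  assumes "\<alpha> \<in> F4" "\<beta> \<in> F4"
  shows "\<beta> \<bullet> coroot \<alpha> \<in> \<int>"
proof -
  obtain p b c d p' b' c' d' :: int where
    v: "\<beta>$1 = p/2" "\<beta>$2 = p/2 + b" "\<beta>$3 = p/2 + c" "\<beta>$4 = p/2 + d" and
    w: "\<alpha>$1 = p'/2" "\<alpha>$2 = p'/2 + b'" "\<alpha>$3 = p'/2 + c'" "\<alpha>$4 = p'/2 + d'"
    using assms by (auto simp: F4_iff in_lat_def)
  let ?t = "2*p*p' + p*(b'+c'+d') + p'*(b+c+d) + 2*(b*b'+c*c'+d*d')"
  have t: "2 * (\<beta> \<bullet> \<alpha>) = of_int ?t"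
    by (simp add: inner4 v w field_simps)
  have co: "\<beta> \<bullet> coroot \<alpha> = 2 * (\<beta> \<bullet> \<alpha>) / (\<alpha> \<bullet> \<alpha>)"
    by (simp add: coroot_def)
  show ?thesis
  proof (cases "\<alpha> \<bullet> \<alpha> = 1")
    case True
    then show ?thesis using co t by simp
  next
    case False
    then have 2: "\<alpha> \<bullet> \<alpha> = 2" using assms F4_iff by blast
    have "even ?t" using long_lat_even[OF w 2] by simp
    then obtain u where "?t = 2 * u" by blast
    then have "\<beta> \<bullet> coroot \<alpha> = of_int u" using co t 2 by simp
    then show ?thesis by simp
  qed
qed

lemma refl_root_scale: "c \<noteq> 0 \<Longrightarrow> refl_root (c *\<^sub>R \<alpha>) v = refl_root \<alpha> v"
  by (simp add: refl_root_def coroot_def)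

lemma refl_root_diff:
  assumes "\<alpha> \<bullet> \<alpha> = \<beta> \<bullet> \<beta>" "\<alpha> \<noteq> \<beta>"
  shows "refl_root (\<alpha> - \<beta>) \<alpha> = \<beta>"
proof -
  have "(\<alpha> - \<beta>) \<bullet> (\<alpha> - \<beta>) = 2 * (\<alpha> \<bullet> (\<alpha> - \<beta>))"
    using assms(1) by (simp add: inner_diff_left inner_diff_right inner_commute)
  moreover have "(\<alpha> - \<beta>) \<bullet> (\<alpha> - \<beta>) \<noteq> 0" using assms(2) by simp
  ultimately have "\<alpha> \<bullet> coroot (\<alpha> - \<beta>) = 1" by (simp add: coroot_def)
  then show ?thesis by (simp add: refl_root_def)
qed

lemma refl_root_invol: "refl_root \<alpha> (refl_root \<alpha> v) = v"
proof (cases "\<alpha> = 0")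
  case False
  then show ?thesis
    by (simp add: refl_root_def coroot_def inner_diff_left field_simps)
qed (simp add: refl_root_def)

lemma refl_root_inner: "refl_root \<alpha> v \<bullet> refl_root \<alpha> v = v \<bullet> v"
proof (cases "\<alpha> = 0")
  case False
  then show ?thesis
    by (simp add: refl_root_def coroot_def inner_diff_left inner_diff_right inner_commute field_simps)
qed (simp add: refl_root_def)

lemma refl_root_F4:
  assumes "\<alpha> \<in> F4" "\<beta> \<in> F4"
  shows "refl_root \<alpha> \<beta> \<in> F4"
  using assms F4_integral[OF assms] in_lat_diff_int
  by (simp add: F4_iff refl_root_inner) (simp add: refl_root_def)

lemma finite_F4: "finite F4"
proof -
  have "F4_long \<subseteq> (\<lambda>(c,d,i,j). c *\<^sub>R \<epsilon> i + d *\<^sub>R \<epsilon> j) ` ({1,-1} \<times> {1,-1} \<times> UNIV \<times> UNIV)"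
  proof
    fix v assume "v \<in> F4_long"
    then obtain c d i j where "c \<in> {1,-1}" "d \<in> {1,-1}" "v = c *\<^sub>R \<epsilon> i + d *\<^sub>R \<epsilon> j"
      unfolding F4_long_def mem_Collect_eq by (elim exE conjE)
    then show "v \<in> (\<lambda>(c,d,i,j). c *\<^sub>R \<epsilon> i + d *\<^sub>R \<epsilon> j) ` ({1,-1} \<times> {1,-1} \<times> UNIV \<times> UNIV)"
      by (intro image_eqI[of _ _ "(c,d,i,j)"]) simp_all
  qed
  then have l: "finite F4_long" by (rule finite_subset) simp
  have "F4_short = (\<lambda>(c,i). c *\<^sub>R \<epsilon> i) ` ({1,-1} \<times> UNIV) \<union>
          (\<lambda>c. (1/2) *\<^sub>R (\<Sum>i\<in>UNIV. c i *\<^sub>R \<epsilon> i)) ` {c. \<forall>i. c i \<in> {1,-1}}"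
    unfolding F4_short_def image_def
    by (intro arg_cong2[of _ _ _ _ "(\<union>)"] Collect_cong) (simp_all add: Bex_def, iprover+)
  note eq = this
  have fin: "finite {c :: 4 \<Rightarrow> real. \<forall>i. c i \<in> {1,-1}}"
    using finite_PiE[of "UNIV :: 4 set" "\<lambda>_. {1,-1::real}"] by (simp add: PiE_def Pi_def)
  have "finite F4_short"
    unfolding eq finite_Un by (intro conjI finite_imageI fin finite_cartesian_product) simp_all
  with l show ?thesis by (simp add: F4_def)
qed

lemma finite_root_system_F4: "finite_root_system F4"
  unfolding finite_root_system_def
proof (intro conjI ballI)
  show "finite F4" by (rule finite_F4)
  have "Basis \<subseteq> F4"
    using eps_in_F4_short by (auto simp: Basis_vec_def \<epsilon>_def F4_def)
  then show "span F4 = UNIV" by (metis span_Basis span_mono top.extremum_uniqueI)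
  show "0 \<notin> F4" by (simp add: F4_iff)
  show "refl_root \<alpha> ` F4 = F4" if "\<alpha> \<in> F4" for \<alpha>
  proof
    show "refl_root \<alpha> ` F4 \<subseteq> F4" using refl_root_F4[OF that] by blast
    show "F4 \<subseteq> refl_root \<alpha> ` F4"
      by (metis image_eqI refl_root_F4 refl_root_invol subsetI that)
  qed
  show "\<beta> \<bullet> coroot \<alpha> \<in> \<int>" if "\<alpha> \<in> F4" "\<beta> \<in> F4" for \<alpha> \<beta>
    by (rule F4_integral[OF that])
qed

lemma inner_eps: "v \<bullet> \<epsilon> i = v $ i"
  by (simp add: \<epsilon>_def inner_axis)

theorem irreducible_root_system_F4: "irreducible_root_system F4"
proof -
  have False if AB: "F4 = A \<union> B" "A \<inter> B = {}" "\<forall>\<alpha>\<in>A. \<forall>\<beta>\<in>B. \<alpha> \<bullet> \<beta> = 0" "B \<noteq> {}"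
    and h: "(\<chi> i. 1/2) \<in> A" for A B
  proof -
    have "\<epsilon> i \<in> A" for i
    proof (rule ccontr)
      assume "\<epsilon> i \<notin> A"
      then have "\<epsilon> i \<in> B" using AB eps_in_F4_short[of i] F4_def by blast
      then have "(\<chi> i. 1/2) \<bullet> \<epsilon> i = (0::real)" using AB(3) h by blast
      then show False by (simp add: inner_eps)
    qed
    then have "\<epsilon> i \<bullet> v = 0" if "v \<in> B" for v i
      using AB(3) that by blast
    then have "v $ i = 0" if "v \<in> B" for v i
      using that inner_eps[of v i] inner_commute[of v "\<epsilon> i"] by simp
    then have "v = 0" if "v \<in> B" for v
      using that by (simp add: vec_eq_iff)
    then show False using AB(1,4) finite_root_system_F4 by (auto simp: finite_root_system_def)
  qed
  note * = this
  have h: "(\<chi> i. 1/2) \<in> F4" using F4_shortI(2)[of "\<chi> i. 1/2"] by (simp add: F4_def)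
  have False if AB: "A \<noteq> {}" "B \<noteq> {}" "A \<inter> B = {}" "F4 = A \<union> B"
    "\<forall>\<alpha>\<in>A. \<forall>\<beta>\<in>B. \<alpha> \<bullet> \<beta> = 0" for A B
  proof (cases "(\<chi> i. 1/2) \<in> A")
    case True
    then show False using *[of A B] AB by blast
  next
    case False
    then have "(\<chi> i. 1/2) \<in> B" using h AB(4) by blast
    moreover have "\<forall>\<alpha>\<in>B. \<forall>\<beta>\<in>A. \<alpha> \<bullet> \<beta> = 0"
      using AB(5) inner_commute by metis
    moreover have "F4 = B \<union> A" "B \<inter> A = {}" using AB(3,4) by blast+
    ultimately show False using *[of B A] AB(1) by blast
  qed
  then show ?thesis
    unfolding irreducible_root_system_def using finite_root_system_F4 by blast
qed

lemma Lambda_refl_subset: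
  assumes "extension_datum R Y \<Lambda>" "\<alpha> \<in> R" "\<beta> \<in> R"
  shows "\<Lambda> \<beta> \<subseteq> \<Lambda> (refl_root \<alpha> \<beta>)"
proof
  fix y assume y: "y \<in> \<Lambda> \<beta>"
  have "0 \<in> \<Lambda> \<alpha>" and "\<forall>z\<in>\<Lambda> \<alpha>. y - (\<beta> \<bullet> coroot \<alpha>) *\<^sub>R z \<in> \<Lambda> (refl_root \<alpha> \<beta>)"
    using assms y unfolding extension_datum_def by auto
  then have "y - (\<beta> \<bullet> coroot \<alpha>) *\<^sub>R 0 \<in> \<Lambda> (refl_root \<alpha> \<beta>)" by blast
  then show "y \<in> \<Lambda> (refl_root \<alpha> \<beta>)" by simp
qed

lemma Lambda_refl:
  assumes "extension_datum F4 Y \<Lambda>" "\<alpha> \<in> F4" "\<beta> \<in> F4"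
  shows "\<Lambda> (refl_root \<alpha> \<beta>) = \<Lambda> \<beta>"
  using Lambda_refl_subset[OF assms] Lambda_refl_subset[OF assms(1,2) refl_root_F4[OF assms(2,3)]]
  by (simp add: refl_root_invol)

lemma Lambda_conj:
  assumes "extension_datum F4 Y \<Lambda>" "\<alpha> \<in> F4" "\<beta> \<in> F4" "\<alpha> \<bullet> \<alpha> = \<beta> \<bullet> \<beta>"
    and "c *\<^sub>R (\<alpha> - \<beta>) \<in> F4"
  shows "\<Lambda> \<alpha> = \<Lambda> \<beta>"
proof -
  have "c \<noteq> 0" "\<alpha> \<noteq> \<beta>"
    using assms(5) finite_root_system_F4 by (auto simp: finite_root_system_def)
  then have "refl_root (c *\<^sub>R (\<alpha> - \<beta>)) \<alpha> = \<beta>"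
    by (simp add: refl_root_scale refl_root_diff assms(4))
  then show ?thesis using Lambda_refl[OF assms(1,5,2)] by simp
qed

lemma Lambda_minus:
  assumes "extension_datum F4 Y \<Lambda>" "\<alpha> \<in> F4"
  shows "- \<alpha> \<in> F4" "\<Lambda> (- \<alpha>) = \<Lambda> \<alpha>"
proof -
  have "\<alpha> \<noteq> 0" using assms(2) finite_root_system_F4 by (auto simp: finite_root_system_def)
  then have "\<alpha> \<bullet> coroot \<alpha> = 2" by (simp add: coroot_def)
  then have "refl_root \<alpha> \<alpha> = - \<alpha>" by (simp add: refl_root_def scaleR_2)
  then show "- \<alpha> \<in> F4" "\<Lambda> (- \<alpha>) = \<Lambda> \<alpha>"
    using refl_root_F4[OF assms(2,2)] Lambda_refl[OF assms(1,2,2)] by simp_all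
qed

lemma Lambda_short_const:
  assumes E: "extension_datum F4 Y \<Lambda>" and "\<alpha> \<in> F4_short"
  shows "\<Lambda> \<alpha> = \<Lambda> (\<epsilon> 1)"
proof -
  have e: "\<epsilon> 1 \<in> F4" "in_lat (\<epsilon> 1)" "\<epsilon> 1 \<bullet> \<epsilon> 1 = 1"
    using eps_in_F4_short[of 1] by (auto simp: F4_def F4_short_iff)
  have pos: "\<Lambda> \<alpha> = \<Lambda> (\<epsilon> 1)" if a: "\<alpha> \<in> F4_short" and ge: "\<alpha> $ 1 \<ge> 0" for \<alpha>
  proof -
    have a': "\<alpha> \<in> F4" "in_lat \<alpha>" "\<alpha> \<bullet> \<alpha> = 1" using a by (auto simp: F4_def F4_short_iff)
    have d: "(\<alpha> - \<epsilon> 1) \<bullet> (\<alpha> - \<epsilon> 1) = 2 - 2 * \<alpha> $ 1"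
      using a'(3) e(3) by (simp add: inner_diff_left inner_diff_right inner_eps inner_commute[of "\<epsilon> 1" \<alpha>])
    have L: "in_lat (\<alpha> - \<epsilon> 1)" using in_lat_diff_int[OF a'(2) e(2), of 1] by simp
    obtain p :: int where p: "\<alpha> $ 1 = p / 2" using a'(2) by (auto simp: in_lat_def)
    have "2 - 2 * \<alpha> $ 1 \<ge> 0" using d by (metis inner_ge_zero)
    then have "p = 0 \<or> p = 1 \<or> p = 2" using p ge by auto
    then show ?thesis
    proof (elim disjE)
      assume "p = 2"
      then have "\<alpha> = \<epsilon> 1" using d p by simp
      then show ?thesis by simp
    qed (use Lambda_conj[OF E a'(1) e(1), of 1] a' e L d p in \<open>simp_all add: F4_iff\<close>)
  qed
  show ?thesis
  proof (cases "\<alpha> $ 1 \<ge> 0")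
    case False
    have "\<alpha> \<in> F4" using assms(2) by (simp add: F4_def)
    note m = Lambda_minus[OF E this]
    have "- \<alpha> \<in> F4_short" using m(1) assms(2) by (auto simp: F4_iff F4_short_iff)
    then show ?thesis using pos[of "-\<alpha>"] m(2) False by simp
  qed (use pos assms in blast)
qed

lemma Lambda_long_const:
  assumes E: "extension_datum F4 Y \<Lambda>" and "\<alpha> \<in> F4_long"
  shows "\<Lambda> \<alpha> = \<Lambda> (\<epsilon> 1 + \<epsilon> 2)"
proof -
  have sgn: "\<Lambda> (\<epsilon> i + d *\<^sub>R \<epsilon> j) = \<Lambda> (\<epsilon> i + \<epsilon> j)"
            "\<Lambda> (c *\<^sub>R \<epsilon> i + d *\<^sub>R \<epsilon> j) = \<Lambda> (\<epsilon> i + d *\<^sub>R \<epsilon> j)"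
    if "c \<in> {1,-1}" "d \<in> {1,-1}" "i \<noteq> j" for c d i j
  proof -
    have r: "refl_root (\<epsilon> k) v = v - (2 * v $ k) *\<^sub>R \<epsilon> k" for v k
      by (simp add: refl_root_def coroot_def inner_eps eps_nth)
    have k: "\<epsilon> k \<in> F4" for k using eps_in_F4_short by (simp add: F4_def)
    have l: "c *\<^sub>R \<epsilon> i + d *\<^sub>R \<epsilon> j \<in> F4" if "c \<in> {1,-1}" "d \<in> {1,-1}" for c d
      using F4_longI[OF that \<open>i \<noteq> j\<close> refl] by (simp add: F4_def)
    have "refl_root (\<epsilon> j) (\<epsilon> i + \<epsilon> j) = \<epsilon> i + (-1) *\<^sub>R \<epsilon> j"
      "refl_root (\<epsilon> i) (\<epsilon> i + d *\<^sub>R \<epsilon> j) = (-1) *\<^sub>R \<epsilon> i + d *\<^sub>R \<epsilon> j"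
      using \<open>i \<noteq> j\<close> by (simp_all add: r vec_eq_iff eps_nth)
    moreover have "\<epsilon> i + \<epsilon> j \<in> F4" "\<epsilon> i + d *\<^sub>R \<epsilon> j \<in> F4"
      using l[of 1 1] l[of 1 d] \<open>d \<in> {1,-1}\<close> by simp_all
    ultimately have "\<Lambda> (\<epsilon> i + (-1) *\<^sub>R \<epsilon> j) = \<Lambda> (\<epsilon> i + \<epsilon> j)"
      "\<Lambda> ((-1) *\<^sub>R \<epsilon> i + d *\<^sub>R \<epsilon> j) = \<Lambda> (\<epsilon> i + d *\<^sub>R \<epsilon> j)"
      using Lambda_refl[OF E k] by metis+
    then show "\<Lambda> (\<epsilon> i + d *\<^sub>R \<epsilon> j) = \<Lambda> (\<epsilon> i + \<epsilon> j)"
      "\<Lambda> (c *\<^sub>R \<epsilon> i + d *\<^sub>R \<epsilon> j) = \<Lambda> (\<epsilon> i + d *\<^sub>R \<epsilon> j)"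
      using that(1,2) by (metis insertE empty_iff scaleR_one)+
  qed
  have sw: "\<Lambda> (\<epsilon> i + \<epsilon> j) = \<Lambda> (\<epsilon> i + \<epsilon> k)" if "i \<noteq> j" "i \<noteq> k" for i j k
  proof (cases "j = k")
    case False
    have "\<epsilon> i + \<epsilon> j \<in> F4_long" "\<epsilon> i + \<epsilon> k \<in> F4_long" "\<epsilon> j - \<epsilon> k \<in> F4_long"
      using that False F4_longI[of 1 1] F4_longI[of 1 "-1" j k] by force+
    then show ?thesis
      using Lambda_conj[OF E, of "\<epsilon> i + \<epsilon> j" "\<epsilon> i + \<epsilon> k" 1] by (simp add: F4_def F4_long_iff)
  qed simp
  obtain c d i j where cd: "c \<in> {1,-1}" "d \<in> {1,-1}" "i \<noteq> j" "\<alpha> = c *\<^sub>R \<epsilon> i + d *\<^sub>R \<epsilon> j"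
    using assms(2) unfolding F4_long_def by blast
  have "\<Lambda> \<alpha> = \<Lambda> (\<epsilon> i + \<epsilon> j)" using sgn cd by metis
  also have "\<dots> = \<Lambda> (\<epsilon> 1 + \<epsilon> 2)"
    using sw cd(3) neq4(1) by (metis add.commute)
  finally show ?thesis .
qed

theorem Lambda_short_eq:
  assumes "extension_datum F4 Y \<Lambda>" "\<alpha> \<in> F4_short"
  shows "Lambda_short F4 \<Lambda> = \<Lambda> \<alpha>"
  unfolding Lambda_short_def short_roots_F4
  using Lambda_short_const[OF assms(1)] assms(2) by (intro the_equality) metis+

theorem Lambda_long_eq:
  assumes "extension_datum F4 Y \<Lambda>" "\<alpha> \<in> F4_long"
  shows "Lambda_long F4 \<Lambda> = \<Lambda> \<alpha>"
  unfolding Lambda_long_def long_roots_F4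
  using Lambda_long_const[OF assms(1)] assms(2) by (intro the_equality) metis+

end

theory Submission
  imports Defs
begin

text \<open>
  Write \<open>S\<close> and \<open>L\<close> for the values of \<open>\<Lambda>\<close> on short and long roots. A homomorphism \<open>\<tau>\<close> from the
  lattice of short roots to \<open>S / H\<close>, where \<open>H\<close> contains \<open>L\<close>, yields the closed set consisting of
  \<open>\<alpha> \<oplus> \<tau>(\<alpha>)\<close> for short \<open>\<alpha>\<close> and \<open>\<beta> \<oplus> L\<close> for long \<open>\<beta>\<close> with \<open>\<tau>(\<beta>) = 0\<close>. It is proper with semi-closed
  gradient as soon as \<open>\<tau>\<close> does not vanish on all long roots, which for index two means that exactly
  two of the \<open>\<tau>(\<epsilon>\<^sub>i)\<close> are nonzero. It is then maximal: any further root produces a short root with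
  full fibre, and this property spreads to all short and then to all long roots.

  Conversely, let \<open>\<Psi>\<close> be maximal with semi-closed gradient \<open>G\<close>. Adding to \<open>G\<close> the long sums of two
  short roots of \<open>G\<close> gives a closed subset of \<open>F\<^sub>4\<close>, which is all of \<open>F\<^sub>4\<close> because otherwise it lifts
  to a closed subroot system containing \<open>\<Psi>\<close> whose gradient is closed. Hence \<open>G\<close> contains every
  short root. The fibres of \<open>\<Psi>\<close> over the short roots are then cosets \<open>F(\<alpha>) + K\<close> of one subgroup \<open>K\<close> with \<open>F\<close> linear, and
  \<open>F(\<beta>) \<notin> K + L\<close> for a long root \<open>\<beta> \<notin> G\<close>. Since \<open>2S \<subseteq> L\<close>, a subgroup \<open>H\<close> of \<open>S\<close> maximal among
  those containing \<open>K + L\<close> but not \<open>F(\<beta>)\<close> has index two, and \<open>\<Psi>\<close> lies in the system of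
  \<open>\<tau> = F mod H\<close>, so that equality holds by maximality.
\<close>

section \<open>Additive subgroups\<close>

text \<open>Subgroups are kept as plain sets, so that real scalars can act on their elements;
  \<open>subgroup_additive_grp_iff\<close> translates to the group records used in the
  statement.\<close>

definition additive_subgroup :: "'a::ab_group_add set \<Rightarrow> bool" where
  "additive_subgroup G \<longleftrightarrow> 0 \<in> G \<and> (\<forall>x\<in>G. \<forall>y\<in>G. x - y \<in> G)"

lemma additive_subgroupI:
  "0 \<in> G \<Longrightarrow> (\<And>x y. x \<in> G \<Longrightarrow> y \<in> G \<Longrightarrow> x - y \<in> G) \<Longrightarrow> additive_subgroup G"
  by (simp add: additive_subgroup_def)

lemma additive_subgroup_zero: "additive_subgroup G \<Longrightarrow> 0 \<in> G"
  by (simp add: additive_subgroup_def)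

lemma additive_subgroup_diff: "additive_subgroup G \<Longrightarrow> x \<in> G \<Longrightarrow> y \<in> G \<Longrightarrow> x - y \<in> G"
  by (simp add: additive_subgroup_def)

lemma additive_subgroup_minus: "additive_subgroup G \<Longrightarrow> x \<in> G \<Longrightarrow> - x \<in> G"
  using additive_subgroup_diff[of G 0 x] additive_subgroup_zero by auto

lemma additive_subgroup_add: "additive_subgroup G \<Longrightarrow> x \<in> G \<Longrightarrow> y \<in> G \<Longrightarrow> x + y \<in> G"
  using additive_subgroup_diff[of G x "- y"] additive_subgroup_minus by auto

lemma additive_subgroup_add_iff:
  "additive_subgroup G \<Longrightarrow> x \<in> G \<Longrightarrow> x + y \<in> G \<longleftrightarrow> y \<in> G"
  using additive_subgroup_diff[of G "x + y" x] additive_subgroup_add by auto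

lemma additive_subgroup_scaleR_nat:
  fixes x :: "'a::real_vector"
  shows "additive_subgroup G \<Longrightarrow> x \<in> G \<Longrightarrow> real n *\<^sub>R x \<in> G"
  by (induction n) (auto simp: additive_subgroup_zero algebra_simps intro: additive_subgroup_add)

lemma additive_subgroup_scaleR_int:
  fixes x :: "'a::real_vector"
  assumes "additive_subgroup G" "x \<in> G" "c \<in> \<int>"
  shows "c *\<^sub>R x \<in> G"
proof -
  obtain k :: int where "c = k" using assms(3) by (elim Ints_cases)
  note pos = additive_subgroup_scaleR_nat[OF assms(1,2)]
  show ?thesis
  proof (cases k rule: int_cases2)
    case (nonneg n)
    then show ?thesis using pos[of n] \<open>c = k\<close> by simp
  next
    case (nonpos n)
    then show ?thesis using additive_subgroup_minus[OF assms(1) pos[of n]] \<open>c = k\<close> by simp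
  qed
qed

lemma additive_subgroup_sums:
  assumes "additive_subgroup G" "additive_subgroup H"
  shows "additive_subgroup {x + y | x y. x \<in> G \<and> y \<in> H}"
proof (rule additive_subgroupI)
  show "0 \<in> {x + y | x y. x \<in> G \<and> y \<in> H}"
    using assms[THEN additive_subgroup_zero] by (intro CollectI exI[of _ 0]) simp
next
  fix u v assume "u \<in> {x + y | x y. x \<in> G \<and> y \<in> H}" "v \<in> {x + y | x y. x \<in> G \<and> y \<in> H}"
  then obtain x y x' y' where *: "x \<in> G" "y \<in> H" "x' \<in> G" "y' \<in> H" "u = x + y" "v = x' + y'"
    by blast
  then have "u - v = (x - x') + (y - y')" by simp
  moreover have "x - x' \<in> G" "y - y' \<in> H" using * assms by (simp_all add: additive_subgroup_diff)
  ultimately show "u - v \<in> {x + y | x y. x \<in> G \<and> y \<in> H}" by blast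
qed

text \<open>Two elements of the union already lie in a common member of the chain; this supplies the
  upper bounds for Zorn's lemma.\<close>

lemma additive_subgroup_Union_chain:
  assumes "\<C> \<noteq> {}" "subset.chain \<A> \<C>" "\<And>G. G \<in> \<A> \<Longrightarrow> additive_subgroup G"
  shows "additive_subgroup (\<Union>\<C>)"
proof (rule additive_subgroupI)
  show "0 \<in> \<Union>\<C>"
    using assms additive_subgroup_zero unfolding subset.chain_def by fast
next
  fix x y assume "x \<in> \<Union>\<C>" "y \<in> \<Union>\<C>"
  then obtain X Y where XY: "x \<in> X" "y \<in> Y" "X \<in> \<C>" "Y \<in> \<C>" by blast
  then have "X \<subseteq> Y \<or> Y \<subseteq> X" using assms(2) unfolding subset.chain_def by auto
  then obtain Z where "x \<in> Z" "y \<in> Z" "Z \<in> \<C>" using XY by blast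
  moreover from \<open>Z \<in> \<C>\<close> have "additive_subgroup Z"
    using assms(2,3) unfolding subset.chain_def by blast
  ultimately show "x - y \<in> \<Union>\<C>" using additive_subgroup_diff by blast
qed

text \<open>\<open>S / B\<close> is a vector space over the field with two elements, and
  \<open>H\<close> corresponds to a hyperplane missing \<open>x\<close>. Zorn's lemma gives
  \<open>H\<close> maximal among the subgroups between \<open>B\<close> and \<open>S\<close> that
  omit \<open>x\<close>. For \<open>y\<close> outside \<open>H\<close>, the union of
  \<open>H\<close> and \<open>H + y\<close> is a strictly larger subgroup, so it contains
  \<open>x\<close>, and \<open>y - x\<close> lies in \<open>H\<close>.\<close>

lemma ex_index_two_avoiding:
  assumes S: "additive_subgroup S" and B: "additive_subgroup B" "B \<subseteq> S"
    and double: "\<And>s. s \<in> S \<Longrightarrow> s + s \<in> B" and x: "x \<in> S" "x \<notin> B"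
  shows "\<exists>H. additive_subgroup H \<and> B \<subseteq> H \<and> H \<subseteq> S \<and> x \<notin> H \<and>
    (\<forall>y\<in>S. y \<notin> H \<longrightarrow> y - x \<in> H)"
proof -
  let ?A = "{G. additive_subgroup G \<and> B \<subseteq> G \<and> G \<subseteq> S \<and> x \<notin> G}"
  have "\<exists>H\<in>?A. \<forall>G\<in>?A. H \<subseteq> G \<longrightarrow> G = H"
  proof (rule subset_Zorn_nonempty)
    show "?A \<noteq> {}" using B x(2) by auto
    show "\<Union>\<C> \<in> ?A" if "\<C> \<noteq> {}" "subset.chain ?A \<C>" for \<C>
    proof -
      have *: "B \<subseteq> G" "G \<subseteq> S" "x \<notin> G" if "G \<in> \<C>" for G
        using that \<open>subset.chain ?A \<C>\<close> unfolding subset.chain_def by blast+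
      have "additive_subgroup (\<Union>\<C>)"
        by (rule additive_subgroup_Union_chain[OF that]) simp
      moreover have "B \<subseteq> \<Union>\<C>" using * that(1) by fast
      moreover have "\<Union>\<C> \<subseteq> S" "x \<notin> \<Union>\<C>" using * by fast+
      ultimately show ?thesis by simp
    qed
  qed
  then obtain H where "H \<in> ?A" and max: "\<forall>G\<in>?A. H \<subseteq> G \<longrightarrow> G = H"
    by (rule bexE)
  then have H: "additive_subgroup H" "B \<subseteq> H" "H \<subseteq> S" "x \<notin> H" by simp_all
  have "y - x \<in> H" if y: "y \<in> S" "y \<notin> H" for y
  proof -
    let ?G = "{g. g \<in> H \<or> g - y \<in> H}"
    have yy: "y + y \<in> H" using double[OF y(1)] H(2) by blast
    have "additive_subgroup ?G"
    proof (rule additive_subgroupI)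
      fix u v assume "u \<in> ?G" "v \<in> ?G"
      then consider "u \<in> H" "v \<in> H" | "u - y \<in> H" "v \<in> H" | "u \<in> H" "v - y \<in> H"
        | "u - y \<in> H" "v - y \<in> H" by blast
      then show "u - v \<in> ?G"
      proof cases
        case 1
        then show ?thesis using additive_subgroup_diff[OF H(1), of u v] by simp
      next
        case 2
        then show ?thesis using additive_subgroup_diff[OF H(1), of "u - y" v]
          by (simp add: algebra_simps)
      next
        case 3
        \<comment> \<open>Here \<open>u - v - y = (u - (v - y)) - (y + y)\<close>, which is where
          \<open>y + y \<in> H\<close> enters.\<close>
        then show ?thesis
          using additive_subgroup_diff[OF H(1) additive_subgroup_diff[OF H(1), of u "v - y"] yy]
          by (simp add: algebra_simps)
      next
        case 4
        then show ?thesis using additive_subgroup_diff[OF H(1), of "u - y" "v - y"] by simp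
      qed
    qed (simp add: additive_subgroup_zero[OF H(1)])
    moreover have "y \<in> ?G" using additive_subgroup_zero[OF H(1)] by simp
    moreover have "?G \<subseteq> S"
    proof
      fix g assume "g \<in> ?G"
      then have "g \<in> S \<or> g - y \<in> S" using H(3) by blast
      then show "g \<in> S" using additive_subgroup_add[OF S _ y(1), of "g - y"] by auto
    qed
    moreover have "H \<subseteq> ?G" by blast
    moreover have "B \<subseteq> ?G" using H(2) by blast
    ultimately have "x \<in> ?G" using max[rule_format, of ?G] y(2) by (metis (no_types, lifting) mem_Collect_eq)
    then have "x - y \<in> H" using H(4) by simp
    then show ?thesis using additive_subgroup_minus[OF H(1), of "x - y"] by simp
  qed
  then show ?thesis using H by blast
qed

section \<open>Cosets, quotients and index two for additive subgroups\<close>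

lemma comm_group_additive_grp:
  assumes "additive_subgroup S"
  shows "comm_group (additive_grp S)"
proof (rule comm_groupI)
  fix x assume "x \<in> carrier (additive_grp S)"
  then show "\<exists>y\<in>carrier (additive_grp S). y \<otimes>\<^bsub>additive_grp S\<^esub> x = \<one>\<^bsub>additive_grp S\<^esub>"
    using additive_subgroup_minus[OF assms] by (auto simp: additive_grp_def intro: bexI[of _ "- x"])
qed (use assms additive_subgroup_zero additive_subgroup_add in
    \<open>auto simp: additive_grp_def add.assoc add.commute\<close>)

lemma inv_additive_grp:
  assumes "additive_subgroup S" "x \<in> S"
  shows "inv\<^bsub>additive_grp S\<^esub> x = - x"
proof -
  interpret comm_group "additive_grp S" by (rule comm_group_additive_grp[OF assms(1)])
  show ?thesis
    by (rule inv_equality) (use assms additive_subgroup_minus in \<open>auto simp: additive_grp_def\<close>)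
qed

lemma subgroup_additive_grp_iff:
  assumes "additive_subgroup S"
  shows "subgroup H (additive_grp S) \<longleftrightarrow> additive_subgroup H \<and> H \<subseteq> S"
proof
  assume H: "subgroup H (additive_grp S)"
  have sub: "H \<subseteq> S" using subgroup.subset[OF H] by (simp add: additive_grp_def)
  have "- y \<in> H" if "y \<in> H" for y
    using subgroup.m_inv_closed[OF H that] inv_additive_grp[OF assms] that sub by auto
  then have "x - y \<in> H" if "x \<in> H" "y \<in> H" for x y
    using subgroup.m_closed[OF H, of x "- y"] that by (simp add: additive_grp_def)
  moreover have "0 \<in> H" using subgroup.one_closed[OF H] by (simp add: additive_grp_def)
  ultimately show "additive_subgroup H \<and> H \<subseteq> S" using sub by (simp add: additive_subgroupI)
next
  assume H: "additive_subgroup H \<and> H \<subseteq> S"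
  show "subgroup H (additive_grp S)"
  proof
    fix x assume "x \<in> H"
    then show "inv\<^bsub>additive_grp S\<^esub> x \<in> H"
      using H inv_additive_grp[OF assms] additive_subgroup_minus by (metis subsetD)
  qed (use H additive_subgroup_zero additive_subgroup_add in \<open>auto simp: additive_grp_def\<close>)
qed

lemma r_coset_additive_grp:
  assumes "additive_subgroup H"
  shows "H #>\<^bsub>additive_grp S\<^esub> x = {y. y - x \<in> H}"
  by (force simp: r_coset_def additive_grp_def)

lemma coset_eq_iff:
  assumes "additive_subgroup H"
  shows "{z. z - x \<in> H} = {z. z - y \<in> H} \<longleftrightarrow> x - y \<in> H"
proof
  assume "{z. z - x \<in> H} = {z. z - y \<in> H}"
  moreover have "x \<in> {z. z - x \<in> H}" using additive_subgroup_zero[OF assms] by simp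
  ultimately show "x - y \<in> H" by blast
next
  assume d: "x - y \<in> H"
  have "z - x \<in> H \<longleftrightarrow> z - y \<in> H" for z
    using additive_subgroup_add_iff[OF assms d, of "z - x"] by simp
  then show "{z. z - x \<in> H} = {z. z - y \<in> H}" by blast
qed

lemma rcosets_additive_grp:
  assumes "additive_subgroup H"
  shows "rcosets\<^bsub>additive_grp S\<^esub> H = (\<lambda>x. {y. y - x \<in> H}) ` S"
  by (auto simp: RCOSETS_def r_coset_additive_grp[OF assms]) (auto simp: additive_grp_def)

lemma mem_rcosets_additive_grp:
  assumes "additive_subgroup H" "H \<subseteq> S" "additive_subgroup S"
    and "X \<in> rcosets\<^bsub>additive_grp S\<^esub> H" "x \<in> X"
  shows "x \<in> S" "X = {y. y - x \<in> H}"
proof -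
  obtain s where s: "s \<in> S" "X = {y. y - s \<in> H}"
    using assms(4) by (auto simp: rcosets_additive_grp[OF assms(1)])
  then have d: "x - s \<in> H" using assms(5) by simp
  then have "(x - s) + s \<in> S" using assms(2) s(1) by (intro additive_subgroup_add[OF assms(3)]) auto
  then show "x \<in> S" by simp
  show "X = {y. y - x \<in> H}" unfolding s(2) using coset_eq_iff[OF assms(1), of x s] d by simp
qed

lemma set_mult_cosets_additive_grp:
  assumes S: "additive_subgroup S" and H: "additive_subgroup H" "H \<subseteq> S" and "x \<in> S" "y \<in> S"
  shows "{z. z - x \<in> H} <#>\<^bsub>additive_grp S\<^esub> {z. z - y \<in> H} = {z. z - (x + y) \<in> H}"
proof -
  interpret comm_group "additive_grp S" by (rule comm_group_additive_grp[OF S])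
  interpret normal H "additive_grp S"
    by (rule subgroup_imp_normal) (simp add: subgroup_additive_grp_iff[OF S] H)
  show ?thesis
    using rcos_sum[of x y] assms(4,5)
    by (simp add: r_coset_additive_grp[OF H(1)]) (simp add: additive_grp_def)
qed

text \<open>There are only two cosets, so two elements that both avoid the coset of \<open>0\<close>
  share the other one.\<close>

lemma index_two_diff_mem:
  assumes S: "additive_subgroup S" and H: "additive_subgroup H" "H \<subseteq> S"
    and index: "subgroup_index (additive_grp S) H = 2"
    and xy: "x \<in> S" "x \<notin> H" "y \<in> S" "y \<notin> H"
  shows "y - x \<in> H"
proof -
  define c where "c = (\<lambda>x. {y. y - x \<in> H})"
  have c: "c x = c y \<longleftrightarrow> x - y \<in> H" for x y
    unfolding c_def by (rule coset_eq_iff[OF H(1)])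
  have "card (c ` S) = 2"
    using index by (simp add: subgroup_index_def rcosets_additive_grp[OF H(1)] c_def)
  then obtain X Z where "c ` S = {X, Z}" unfolding card_2_iff by iprover
  then have "c s = X \<or> c s = Z" if "s \<in> S" for s using that by blast
  moreover have "c x \<noteq> c 0" "c y \<noteq> c 0" using c xy by simp_all
  ultimately have "c y = c x" using xy(1,3) additive_subgroup_zero[OF S] by metis
  then show ?thesis using c by simp
qed

text \<open>A strictly larger subgroup contains some \<open>k\<close> outside \<open>H\<close>,
  hence \<open>x = k - (k - x)\<close>, and then every \<open>y\<close> outside \<open>H\<close> as
  \<open>(y - x) + x\<close>. The cosets are those of \<open>0\<close> and \<open>x\<close>.\<close>

lemma index_twoI:
  assumes S: "additive_subgroup S" and H: "additive_subgroup H" "H \<subseteq> S"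
    and x: "x \<in> S" "x \<notin> H" and diff: "\<And>y. y \<in> S \<Longrightarrow> y \<notin> H \<Longrightarrow> y - x \<in> H"
  shows "maximal_subgroup H (additive_grp S)" "subgroup_index (additive_grp S) H = 2"
proof -
  define c where "c = (\<lambda>x. {y. y - x \<in> H})"
  have c: "c x = c y \<longleftrightarrow> x - y \<in> H" for x y
    unfolding c_def by (rule coset_eq_iff[OF H(1)])
  have "K = S" if K: "additive_subgroup K" "K \<subseteq> S" "H \<subseteq> K" "K \<noteq> H" for K
  proof -
    obtain k where k: "k \<in> K" "k \<notin> H" using K by blast
    then have "k - x \<in> H" using diff K(2) by blast
    then have "k - (k - x) \<in> K" using additive_subgroup_diff[OF K(1) k(1)] K(3) by blast
    then have "x \<in> K" by simp
    have "y \<in> K" if "y \<in> S" for y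
    proof (cases "y \<in> H")
      case False
      then have "y - x \<in> K" using diff that K(3) by blast
      then show ?thesis using additive_subgroup_add[OF K(1) _ \<open>x \<in> K\<close>, of "y - x"] by simp
    qed (use K(3) in blast)
    then show ?thesis using K(2) by blast
  qed
  then show "maximal_subgroup H (additive_grp S)"
    unfolding maximal_subgroup_def subgroup_additive_grp_iff[OF S]
    using H x by (auto simp: additive_grp_def)
  have "c y \<in> {c 0, c x}" if "y \<in> S" for y
    using diff[OF that] c[of y x] c[of y 0] by (cases "y \<in> H") simp_all
  then have "c ` S = {c 0, c x}"
    using x(1) additive_subgroup_zero[OF S] by (intro equalityI image_subsetI) simp_all
  moreover have "c 0 \<noteq> c x" using c[of x 0] x(2) by auto
  ultimately show "subgroup_index (additive_grp S) H = 2"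
    by (simp add: subgroup_index_def rcosets_additive_grp[OF H(1)] c_def card_insert_if)
qed

section \<open>Combinatorics of \<open>F\<^sub>4\<close>\<close>

lemma inner_add_self:
  fixes v w :: "'v::real_inner"
  shows "(v + w) \<bullet> (v + w) = v \<bullet> v + 2 * (v \<bullet> w) + w \<bullet> w"
  by (simp add: inner_add_left inner_add_right inner_commute)

lemma in_lat_add: "in_lat v \<Longrightarrow> in_lat w \<Longrightarrow> in_lat (v + w)"
  using in_lat_diff_int[of v w "-1"] by simp

lemma F4_short_inner_self: "\<alpha> \<in> F4_short \<Longrightarrow> \<alpha> \<bullet> \<alpha> = 1"
  by (simp add: F4_short_iff)

lemma F4_long_inner_self: "\<alpha> \<in> F4_long \<Longrightarrow> \<alpha> \<bullet> \<alpha> = 2"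
  by (simp add: F4_long_iff)

lemma F4_short_not_long: "\<alpha> \<in> F4_short \<Longrightarrow> \<alpha> \<notin> F4_long"
  by (simp add: F4_short_iff F4_long_iff)

lemma F4_minus:
  "- \<alpha> \<in> F4_short \<longleftrightarrow> \<alpha> \<in> F4_short" "- \<alpha> \<in> F4_long \<longleftrightarrow> \<alpha> \<in> F4_long"
proof -
  have "in_lat (- v)" if "in_lat v" for v
    using in_lat_diff_int[OF in_lat_diff_int[OF that that, of 1] that, of 1] by simp
  from this this[of "- _", simplified] have "in_lat (- \<alpha>) \<longleftrightarrow> in_lat \<alpha>" by blast
  then show "- \<alpha> \<in> F4_short \<longleftrightarrow> \<alpha> \<in> F4_short" "- \<alpha> \<in> F4_long \<longleftrightarrow> \<alpha> \<in> F4_long"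
    by (simp_all add: F4_short_iff F4_long_iff)
qed

lemma coroot_short: "\<alpha> \<in> F4_short \<Longrightarrow> \<beta> \<bullet> coroot \<alpha> = 2 * (\<beta> \<bullet> \<alpha>)"
  by (simp add: coroot_def F4_short_iff)

lemma coroot_long: "\<alpha> \<in> F4_long \<Longrightarrow> \<beta> \<bullet> coroot \<alpha> = \<beta> \<bullet> \<alpha>"
  by (simp add: coroot_def F4_long_iff)

lemma Ints_abs_le_2:
  fixes x :: real
  assumes "x \<in> \<int>" "\<bar>x\<bar> \<le> 2"
  shows "x = -2 \<or> x = -1 \<or> x = 0 \<or> x = 1 \<or> x = 2"
proof -
  obtain k :: int where k: "x = k" using assms(1) by (elim Ints_cases)
  then have "k = -2 \<or> k = -1 \<or> k = 0 \<or> k = 1 \<or> k = 2" using assms(2) by linarith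
  then show ?thesis using k by auto
qed

lemma inner_F4_long_Ints: "\<alpha> \<in> F4_short \<union> F4_long \<Longrightarrow> \<beta> \<in> F4_long \<Longrightarrow> \<alpha> \<bullet> \<beta> \<in> \<int>"
  using F4_integral[of \<beta> \<alpha>] by (simp add: F4_def coroot_long)

text \<open>A substitute for the Cauchy-Schwarz inequality that is linear in the squared lengths;
  with integrality it suffices to enumerate the inner products of roots.\<close>

lemma abs_inner_le_half_sum:
  fixes v w :: "'v::real_inner"
  shows "2 * \<bar>v \<bullet> w\<bar> \<le> v \<bullet> v + w \<bullet> w"
proof -
  have "0 \<le> (v + w) \<bullet> (v + w)" "0 \<le> (v + - w) \<bullet> (v + - w)" by (rule inner_ge_zero)+
  then show ?thesis unfolding inner_add_self by auto
qed

lemma inner_short_short: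
  assumes "\<alpha> \<in> F4_short" "\<beta> \<in> F4_short"
  shows "\<alpha> \<bullet> \<beta> = -1 \<or> \<alpha> \<bullet> \<beta> = -1/2 \<or> \<alpha> \<bullet> \<beta> = 0 \<or> \<alpha> \<bullet> \<beta> = 1/2 \<or> \<alpha> \<bullet> \<beta> = 1"
proof -
  have "2 * (\<alpha> \<bullet> \<beta>) \<in> \<int>"
    using F4_integral[of \<beta> \<alpha>] assms coroot_short by (simp add: F4_def)
  moreover have "\<bar>2 * (\<alpha> \<bullet> \<beta>)\<bar> \<le> 2"
    using abs_inner_le_half_sum[of \<alpha> \<beta>] assms by (simp add: F4_short_inner_self)
  ultimately show ?thesis using Ints_abs_le_2 by force
qed

lemma inner_short_long:
  assumes "\<alpha> \<in> F4_short" "\<beta> \<in> F4_long"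
  shows "\<alpha> \<bullet> \<beta> = -1 \<or> \<alpha> \<bullet> \<beta> = 0 \<or> \<alpha> \<bullet> \<beta> = 1"
proof -
  have "\<bar>\<alpha> \<bullet> \<beta>\<bar> \<le> 3/2"
    using abs_inner_le_half_sum[of \<alpha> \<beta>] assms by (simp add: F4_short_inner_self F4_long_inner_self)
  then show ?thesis using Ints_abs_le_2[OF inner_F4_long_Ints] assms by force
qed

lemma inner_long_long:
  assumes "\<alpha> \<in> F4_long" "\<beta> \<in> F4_long"
  shows "\<alpha> \<bullet> \<beta> = -2 \<or> \<alpha> \<bullet> \<beta> = -1 \<or> \<alpha> \<bullet> \<beta> = 0 \<or> \<alpha> \<bullet> \<beta> = 1 \<or> \<alpha> \<bullet> \<beta> = 2"
  using abs_inner_le_half_sum[of \<alpha> \<beta>] assms Ints_abs_le_2[OF inner_F4_long_Ints, of \<alpha> \<beta>]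
  by (simp add: F4_long_inner_self)

lemma inner_min_imp_minus:
  fixes v w :: "'v::real_inner"
  assumes "v \<bullet> v + 2 * (v \<bullet> w) + w \<bullet> w = 0"
  shows "w = - v"
  using assms unfolding inner_add_self[symmetric] by (simp add: add_eq_0_iff)

text \<open>Lattice membership is automatic for sums, so only the squared length
  \<open>2 + 2 * (\<alpha> \<bullet> \<beta>)\<close> has to be compared with 1. The criteria below
  follow the same pattern.\<close>

lemma short_plus_short_short:
  assumes "\<alpha> \<in> F4_short" "\<beta> \<in> F4_short"
  shows "\<alpha> + \<beta> \<in> F4_short \<longleftrightarrow> \<alpha> \<bullet> \<beta> = -1/2"
  using assms in_lat_add[of \<alpha> \<beta>] by (auto simp: F4_short_iff inner_add_self)

lemma short_minus_short_short:
  assumes "\<alpha> \<in> F4_short" "\<beta> \<in> F4_short"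
  shows "\<alpha> - \<beta> \<in> F4_short \<longleftrightarrow> \<alpha> \<bullet> \<beta> = 1/2"
  using short_plus_short_short[of \<alpha> "- \<beta>"] assms by (auto simp: F4_minus)

lemma short_plus_long_short:
  assumes "\<alpha> \<in> F4_short" "\<beta> \<in> F4_long"
  shows "\<alpha> + \<beta> \<in> F4_short \<longleftrightarrow> \<alpha> \<bullet> \<beta> = -1"
  using assms in_lat_add[of \<alpha> \<beta>] by (auto simp: F4_short_iff F4_long_iff inner_add_self)

text \<open>The squared length is \<open>3 + 2 * (\<alpha> \<bullet> \<beta>)\<close> with an
  integral inner product, hence odd.\<close>

lemma short_plus_long_not_long:
  assumes "\<alpha> \<in> F4_short" "\<beta> \<in> F4_long"
  shows "\<alpha> + \<beta> \<notin> F4_long"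
  using assms inner_short_long[OF assms] by (auto simp: F4_short_iff F4_long_iff inner_add_self)

lemma long_plus_long_long:
  assumes "\<alpha> \<in> F4_long" "\<beta> \<in> F4_long"
  shows "\<alpha> + \<beta> \<in> F4_long \<longleftrightarrow> \<alpha> \<bullet> \<beta> = -1"
  using assms in_lat_add[of \<alpha> \<beta>] by (auto simp: F4_long_iff inner_add_self)

text \<open>The squared length is \<open>4 + 2 * (\<alpha> \<bullet> \<beta>)\<close> with an
  integral inner product, hence even.\<close>

lemma long_plus_long_not_short:
  assumes "\<alpha> \<in> F4_long" "\<beta> \<in> F4_long"
  shows "\<alpha> + \<beta> \<notin> F4_short"
  using assms inner_long_long[OF assms] by (auto simp: F4_short_iff F4_long_iff inner_add_self)

lemma F4_long_eq_sum:
  assumes "\<beta> \<in> F4_long"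
  obtains \<alpha> \<gamma> where "\<alpha> \<in> F4_short" "\<gamma> \<in> F4_short" "\<beta> = \<alpha> + \<gamma>"
proof -
  obtain c d i j where "c \<in> {1,-1}" "d \<in> {1,-1}" "i \<noteq> j" "\<beta> = c *\<^sub>R \<epsilon> i + d *\<^sub>R \<epsilon> j"
    using assms unfolding F4_long_def by blast
  then show thesis using that[of "c *\<^sub>R \<epsilon> i" "d *\<^sub>R \<epsilon> j"] F4_shortI(1) by blast
qed

section \<open>Connectedness and generation of the short roots\<close>

definition half_sum :: "real^4" where
  "half_sum = (\<chi> i. 1/2)"

lemma half_sum_nth [simp]: "half_sum $ i = 1/2"
  by (simp add: half_sum_def)

lemma half_sum_short: "half_sum \<in> F4_short"
  by (rule F4_shortI(2)) simp

lemma inner_half_sum_eps: "half_sum \<bullet> \<epsilon> i = 1/2"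
  by (simp add: inner_eps)

lemma F4_short_cases:
  assumes "\<alpha> \<in> F4_short"
  obtains c i where "c \<in> {1, -1}" "\<alpha> = c *\<^sub>R \<epsilon> i" | "\<And>i. \<alpha> $ i = 1/2 \<or> \<alpha> $ i = -1/2"
proof -
  consider c i where "c \<in> {1, -1}" "\<alpha> = c *\<^sub>R \<epsilon> i"
    | c where "\<forall>i. c i \<in> {1, -1::real}" "\<alpha> = (1/2) *\<^sub>R (\<Sum>i\<in>UNIV. c i *\<^sub>R \<epsilon> i)"
    using assms unfolding F4_short_def by blast
  then show thesis
  proof cases
    case 2
    have "\<alpha> $ i = 1/2 \<or> \<alpha> $ i = -1/2" for i
    proof -
      have "\<alpha> $ i = c i / 2"
        using 2(2) exhaust_4[of i] by (auto simp: sum_4 eps_nth)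
      then show ?thesis using 2(1)[rule_format, of i] by auto
    qed
    then show thesis by (rule that(2))
  qed (rule that(1))
qed

text \<open>Join two short roots when their inner product is 1/2 or -1/2. Then
  \<open>half_sum\<close> is adjacent to every signed \<open>\<epsilon> i\<close>, and every
  half-integral root is adjacent to \<open>\<epsilon> 1\<close>, so all short roots are connected
  through \<open>half_sum\<close>.\<close>

lemma F4_short_connected:
  assumes base: "\<alpha>0 \<in> F4_short" "P \<alpha>0"
    and step: "\<And>\<alpha> \<gamma>. \<alpha> \<in> F4_short \<Longrightarrow> \<gamma> \<in> F4_short \<Longrightarrow> P \<alpha> \<Longrightarrow> \<bar>\<alpha> \<bullet> \<gamma>\<bar> = 1/2 \<Longrightarrow> P \<gamma>"
    and "\<gamma> \<in> F4_short"
  shows "P \<gamma>"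
proof -
  have half: "P half_sum"
  proof (cases rule: F4_short_cases[OF base(1)])
    case (1 c i)
    then have "\<bar>\<alpha>0 \<bullet> half_sum\<bar> = 1/2"
      by (auto simp: inner_half_sum_eps inner_commute[of "\<epsilon> i"])
    then show ?thesis using step base half_sum_short by blast
  next
    case 2
    have "\<bar>\<alpha>0 \<bullet> \<epsilon> 1\<bar> = 1/2" using 2[of 1] by (auto simp: inner_eps)
    then have "P (\<epsilon> 1)" using step base eps_in_F4_short by blast
    moreover have "\<bar>\<epsilon> 1 \<bullet> half_sum\<bar> = 1/2" by (simp add: inner_half_sum_eps inner_commute)
    ultimately show ?thesis using step half_sum_short eps_in_F4_short by blast
  qed
  show ?thesis
  proof (cases rule: F4_short_cases[OF assms(4)])
    case (1 c i)
    then have "\<bar>half_sum \<bullet> \<gamma>\<bar> = 1/2" by (auto simp: inner_half_sum_eps)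
    then show ?thesis using step half half_sum_short assms(4) by blast
  next
    case 2
    have "\<bar>half_sum \<bullet> \<epsilon> 1\<bar> = 1/2" by (simp add: inner_half_sum_eps)
    then have "P (\<epsilon> 1)" using step half half_sum_short eps_in_F4_short by blast
    moreover have "\<bar>\<epsilon> 1 \<bullet> \<gamma>\<bar> = 1/2" using 2[of 1] by (auto simp: inner_eps inner_commute[of _ \<gamma>])
    ultimately show ?thesis using step eps_in_F4_short assms(4) by blast
  qed
qed

text \<open>Either \<open>half_sum\<close> or \<open>\<epsilon> 1\<close> has inner product of
  absolute value 1/2 with \<open>\<alpha>\<close>; negation corrects the sign.\<close>

lemma F4_short_ex_neighbour:
  assumes "\<alpha> \<in> F4_short"
  obtains \<gamma> where "\<gamma> \<in> F4_short" "\<alpha> \<bullet> \<gamma> = 1/2"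
proof -
  have "\<exists>\<gamma>\<in>F4_short. \<bar>\<alpha> \<bullet> \<gamma>\<bar> = 1/2"
  proof (cases rule: F4_short_cases[OF assms])
    case (1 c i)
    then have "\<bar>\<alpha> \<bullet> half_sum\<bar> = 1/2"
      by (auto simp: inner_half_sum_eps inner_commute[of "\<epsilon> i"])
    then show ?thesis using half_sum_short by blast
  next
    case 2
    have "\<bar>\<alpha> \<bullet> \<epsilon> 1\<bar> = 1/2" using 2[of 1] by (auto simp: inner_eps)
    then show ?thesis using eps_in_F4_short by blast
  qed
  then obtain \<gamma> where "\<gamma> \<in> F4_short" "\<alpha> \<bullet> \<gamma> = 1/2 \<or> \<alpha> \<bullet> (- \<gamma>) = 1/2"
    by (auto simp: abs_if split: if_splits)
  then show thesis using that[of \<gamma>] that[of "- \<gamma>"] by (auto simp: F4_minus)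
qed

text \<open>
  The signs of a half-integral root are changed one at a time, starting from \<open>half_sum\<close>.
\<close>

lemma F4_short_generated:
  assumes gen: "P half_sum" "\<And>i. i \<noteq> 4 \<Longrightarrow> P (\<epsilon> i)"
    and minus: "\<And>\<alpha>. \<alpha> \<in> F4_short \<Longrightarrow> P \<alpha> \<Longrightarrow> P (- \<alpha>)"
    and add: "\<And>\<alpha> \<gamma>. \<alpha> \<in> F4_short \<Longrightarrow> \<gamma> \<in> F4_short \<Longrightarrow> \<alpha> + \<gamma> \<in> F4_short \<Longrightarrow>
       P \<alpha> \<Longrightarrow> P \<gamma> \<Longrightarrow> P (\<alpha> + \<gamma>)"
    and "\<alpha> \<in> F4_short"
  shows "P \<alpha>"
proof -
  \<comment> \<open>The value \<open>b = 0\<close> covers a sign that is left as it is, so one fact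
    handles all coordinates.\<close>
  have flip: "P (\<alpha> - b *\<^sub>R \<epsilon> i) \<and> \<alpha> - b *\<^sub>R \<epsilon> i \<in> F4_short"
    if "\<alpha> \<in> F4_short" "P \<alpha>" "\<alpha> $ i = 1/2" "i \<noteq> 4" "b = 0 \<or> b = 1" for \<alpha> i b
  proof -
    have "\<alpha> - \<epsilon> i \<in> F4_short"
      using that by (simp add: short_minus_short_short eps_in_F4_short inner_eps)
    moreover from this have "P (\<alpha> + - \<epsilon> i)"
      using that gen(2) minus eps_in_F4_short by (intro add) (simp_all add: F4_minus)
    ultimately show ?thesis using that by auto
  qed
  have pos: "P \<alpha>" if \<alpha>: "\<And>i. \<alpha> $ i = 1/2 \<or> \<alpha> $ i = -1/2" "\<alpha> $ 4 = 1/2" for \<alpha>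
  proof -
    define b where "b i = 1/2 - \<alpha> $ i" for i
    have b: "b i = 0 \<or> b i = 1" for i using \<alpha>(1)[of i] by (auto simp: b_def)
    let ?v = "half_sum - b 1 *\<^sub>R \<epsilon> 1"
    let ?w = "?v - b 2 *\<^sub>R \<epsilon> 2"
    have v: "P ?v \<and> ?v \<in> F4_short"
      by (rule flip) (simp_all add: gen half_sum_short b)
    have w: "P ?w \<and> ?w \<in> F4_short"
      by (rule flip) (use v in \<open>simp_all add: b eps_nth\<close>)
    have "P (?w - b 3 *\<^sub>R \<epsilon> 3)"
      by (rule flip[THEN conjunct1]) (use w in \<open>simp_all add: b eps_nth\<close>)
    also have "?w - b 3 *\<^sub>R \<epsilon> 3 = \<alpha>"
      using \<alpha>(2) by (simp add: vec_eq_iff forall_4 eps_nth b_def)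
    finally show ?thesis .
  qed
  have half: "P \<alpha>" if \<alpha>: "\<And>i. \<alpha> $ i = 1/2 \<or> \<alpha> $ i = -1/2" for \<alpha>
  proof (cases "\<alpha> $ 4 = 1/2")
    case False
    then have "P (- \<alpha>)" using \<alpha> by (intro pos) force+
    moreover have "- \<alpha> \<in> F4_short" using F4_shortI(2)[OF \<alpha>] by (simp add: F4_minus)
    ultimately show ?thesis using minus by fastforce
  qed (use pos \<alpha> in blast)
  \<comment> \<open>\<open>\<epsilon> 4\<close> is not among the generators; it is
    \<open>half_sum\<close> plus the half-integral root whose only positive coordinate is the
    fourth.\<close>
  have "P (\<epsilon> 4)"
  proof -
    let ?v = "(\<chi> i. if i = 4 then 1/2 else - 1/2) :: real^4"
    have eq: "\<epsilon> 4 = half_sum + ?v" by (simp add: vec_eq_iff eps_nth)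
    have "?v \<in> F4_short" by (rule F4_shortI(2)) simp
    then have "P (half_sum + ?v)"
      using gen(1) half_sum_short eps_in_F4_short[of 4] unfolding eq
      by (intro add half) simp_all
    then show ?thesis by (simp only: eq)
  qed
  then have eps: "P (\<epsilon> i)" for i using gen(2) by (cases "i = 4") simp_all
  show ?thesis
  proof (cases rule: F4_short_cases[OF assms(5)])
    case (1 c i)
    then show ?thesis using eps[of i] minus[OF eps_in_F4_short, of i] by auto
  qed (rule half)
qed

section \<open>The real roots and the twisted subsystems\<close>

definition F4_lattice :: "(real^4) set" where
  "F4_lattice = group_closure F4_short"

lemma F4_lattice_subgroup: "additive_subgroup F4_lattice"
  by (simp add: additive_subgroup_def F4_lattice_def group_closure.diff)

lemma F4_short_lattice: "\<alpha> \<in> F4_short \<Longrightarrow> \<alpha> \<in> F4_lattice"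
  by (simp add: F4_lattice_def group_closure.base)

lemma F4_long_lattice: "\<beta> \<in> F4_long \<Longrightarrow> \<beta> \<in> F4_lattice"
  by (elim F4_long_eq_sum)
    (simp add: additive_subgroup_add[OF F4_lattice_subgroup] F4_short_lattice)

text \<open>\<open>S\<close> and \<open>L\<close> stand for the values of \<open>\<Lambda>\<close>
  on short and long roots. Only these inclusions are kept from the extension datum.\<close>

locale F4_pair =
  fixes S L :: "'y::real_vector set"
  assumes S: "additive_subgroup S" and L: "additive_subgroup L"
    and L_sub: "L \<subseteq> S" and double: "s \<in> S \<Longrightarrow> s + s \<in> L"
begin

definition roots :: "((real^4) \<times> 'y) set" where
  "roots = F4_short \<times> S \<union> F4_long \<times> L"

lemma roots_short: "\<alpha> \<in> F4_short \<Longrightarrow> (\<alpha>, y) \<in> roots \<longleftrightarrow> y \<in> S"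
  using F4_short_not_long by (auto simp: roots_def)

lemma roots_long: "\<beta> \<in> F4_long \<Longrightarrow> (\<beta>, y) \<in> roots \<longleftrightarrow> y \<in> L"
  using F4_short_not_long by (auto simp: roots_def)

lemma roots_F4: "(\<alpha>, y) \<in> roots \<Longrightarrow> \<alpha> \<in> F4 \<and> y \<in> S"
  using L_sub by (auto simp: roots_def F4_def)

lemma closed_subroot_system_sum:
  "closed_subroot_system roots \<Psi> \<Longrightarrow> a \<in> \<Psi> \<Longrightarrow> b \<in> \<Psi> \<Longrightarrow> a + b \<in> roots \<Longrightarrow> a + b \<in> \<Psi>"
  by (simp add: closed_subroot_system_def sum_closed_in_def)

lemma closed_subroot_system_sub: "closed_subroot_system roots \<Psi> \<Longrightarrow> \<Psi> \<subseteq> roots"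
  by (auto simp: closed_subroot_system_def subroot_system_def)

text \<open>The affine reflection of a root in itself is its negative.\<close>

lemma closed_subroot_system_minus:
  assumes "closed_subroot_system roots \<Psi>" "(\<alpha>, y) \<in> \<Psi>"
  shows "(- \<alpha>, - y) \<in> \<Psi>"
proof -
  have "\<alpha> \<noteq> 0"
    using closed_subroot_system_sub[OF assms(1)] assms(2) roots_F4 by (force simp: F4_iff)
  then have "affine_refl (\<alpha>, y) (\<alpha>, y) = (- \<alpha>, - y)"
    by (simp add: affine_refl_def refl_root_def coroot_def scaleR_2)
  moreover have "affine_refl (\<alpha>, y) (\<alpha>, y) \<in> \<Psi>"
    using assms unfolding closed_subroot_system_def subroot_system_def by blast
  ultimately show ?thesis by simp
qed

end

section \<open>From extension data to the pair of subgroups\<close>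

lemma (in F4_pair) real_roots_F4:
  assumes "extension_datum F4 Y \<Lambda>" "S = Lambda_short F4 \<Lambda>" "L = Lambda_long F4 \<Lambda>"
  shows "real_roots F4 \<Lambda> = roots"
proof -
  have "\<And>\<alpha>. \<alpha> \<in> F4_short \<Longrightarrow> \<Lambda> \<alpha> = S" "\<And>\<alpha>. \<alpha> \<in> F4_long \<Longrightarrow> \<Lambda> \<alpha> = L"
    using Lambda_short_eq[OF assms(1)] Lambda_long_eq[OF assms(1)] assms(2,3) by simp_all
  then show ?thesis by (auto simp: real_roots_def roots_def F4_def)
qed

text \<open>Each property is the reflection axiom at one well chosen pair of roots. A coroot pairing
  of 1 between roots of equal length gives closure under differences; pairing 2 of a long root with
  a short coroot gives \<open>2 S \<subseteq> L\<close>, and pairing 1 of a short root with a long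
  coroot gives \<open>L \<subseteq> S\<close>.\<close>

lemma extension_datum_F4_pair:
  assumes E: "extension_datum F4 Y \<Lambda>"
  shows "F4_pair (Lambda_short F4 \<Lambda>) (Lambda_long F4 \<Lambda>)"
proof -
  have ax: "y - (\<beta> \<bullet> coroot \<alpha>) *\<^sub>R z \<in> \<Lambda> (refl_root \<alpha> \<beta>)"
    if "\<alpha> \<in> F4" "\<beta> \<in> F4" "y \<in> \<Lambda> \<beta>" "z \<in> \<Lambda> \<alpha>" for \<alpha> \<beta> y z
    using E that by (simp add: extension_datum_def)
  have zero: "0 \<in> \<Lambda> \<alpha>" if "\<alpha> \<in> F4" for \<alpha>
    using E that by (simp add: extension_datum_def)
  define S where "S = \<Lambda> (\<epsilon> 1)"
  define L where "L = \<Lambda> (\<epsilon> 1 + \<epsilon> 2)"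
  note sh = Lambda_short_const[OF E, folded S_def] and lo = Lambda_long_const[OF E, folded L_def]
  have long: "\<epsilon> 1 + \<epsilon> 2 \<in> F4_long" "\<epsilon> 1 + \<epsilon> 3 \<in> F4_long"
    using F4_longI[of 1 1 1 2] F4_longI[of 1 1 1 3] by simp_all
  note mem = eps_in_F4_short[of 1] half_sum_short long
  have F4: "\<epsilon> 1 \<in> F4" "half_sum \<in> F4" "\<epsilon> 1 + \<epsilon> 2 \<in> F4" "\<epsilon> 1 + \<epsilon> 3 \<in> F4"
    using mem by (simp_all add: F4_def)
  have refl_short: "\<Lambda> (refl_root \<alpha> \<beta>) = S" if "\<alpha> \<in> F4" "\<beta> \<in> F4_short" for \<alpha> \<beta>
    using Lambda_refl[OF E that(1), of \<beta>] that(2) sh by (simp add: F4_def)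
  have refl_long: "\<Lambda> (refl_root \<alpha> \<beta>) = L" if "\<alpha> \<in> F4" "\<beta> \<in> F4_long" for \<alpha> \<beta>
    using Lambda_refl[OF E that(1), of \<beta>] that(2) lo by (simp add: F4_def)
  have z: "0 \<in> S" "0 \<in> L" using zero F4 by (simp_all add: S_def L_def)
  have co: "half_sum \<bullet> coroot (\<epsilon> 1) = 1" "(\<epsilon> 1 + \<epsilon> 3) \<bullet> coroot (\<epsilon> 1 + \<epsilon> 2) = 1"
    "(\<epsilon> 1 + \<epsilon> 2) \<bullet> coroot (\<epsilon> 1) = 2" "\<epsilon> 1 \<bullet> coroot (\<epsilon> 1 + \<epsilon> 2) = 1"
    unfolding coroot_short[OF mem(1)] coroot_long[OF mem(3)] by (simp_all add: inner4 eps_nth)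
  have S: "additive_subgroup S"
  proof (rule additive_subgroupI)
    fix x y assume "x \<in> S" "y \<in> S"
    then show "x - y \<in> S"
      using ax[OF F4(1,2), of x y] sh[OF mem(2)] refl_short[OF F4(1) mem(2)] co(1)
      by (simp add: S_def)
  qed (rule z)
  have L: "additive_subgroup L"
  proof (rule additive_subgroupI)
    fix x y assume "x \<in> L" "y \<in> L"
    then show "x - y \<in> L"
      using ax[OF F4(3,4), of x y] lo[OF mem(4)] refl_long[OF F4(3) mem(4)] co(2)
      by (simp add: L_def)
  qed (rule z)
  have "s + s \<in> L" if "s \<in> S" for s
  proof -
    have "0 - 2 *\<^sub>R s \<in> L"
      using ax[OF F4(1,3), of 0 s] that z refl_long[OF F4(1) mem(3)] co(3)
      by (simp add: S_def L_def)
    from additive_subgroup_minus[OF L this] show ?thesis by (simp add: scaleR_2)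
  qed
  moreover have "s \<in> S" if "s \<in> L" for s
  proof -
    have "0 - s \<in> S"
      using ax[OF F4(3,1), of 0 s] that z refl_short[OF F4(3) mem(1)] co(4)
      by (simp add: S_def L_def)
    from additive_subgroup_minus[OF S this] show ?thesis by simp
  qed
  ultimately have "F4_pair S L" using S L by unfold_locales blast+
  then show ?thesis
    using Lambda_short_eq[OF E mem(1)] Lambda_long_eq[OF E mem(3)] by (simp add: S_def L_def)
qed

lemma gradient_eq_fst:
  assumes "\<Psi> \<subseteq> real_roots R \<Lambda>"
  shows "gradient R \<Lambda> \<Psi> = fst ` \<Psi>"
  using assms by (force simp: gradient_def real_roots_def)

text \<open>\<open>F\<close> lifts a homomorphism from the lattice to \<open>S / H\<close>.\<close>

locale F4_twist = F4_pair S L for S L :: "'y::real_vector set" +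
  fixes H :: "'y set" and F :: "real^4 \<Rightarrow> 'y"
  assumes H: "additive_subgroup H" and L_sub_H: "L \<subseteq> H" and H_sub: "H \<subseteq> S"
    and F_mem: "v \<in> F4_lattice \<Longrightarrow> F v \<in> S"
    and F_add: "v \<in> F4_lattice \<Longrightarrow> w \<in> F4_lattice \<Longrightarrow> F (v + w) - (F v + F w) \<in> H"
begin

text \<open>The system displayed in the theorem, with the coset \<tau>(\<alpha>) written through its
  representative \<open>F \<alpha>\<close> and the condition on index pairs replaced by
  \<open>F \<beta> \<in> H\<close>; \<open>twisted_eq\<close> identifies the two forms.\<close>

definition twisted :: "((real^4) \<times> 'y) set" where
  "twisted = {(\<alpha>, y). \<alpha> \<in> F4_short \<and> y - F \<alpha> \<in> H} \<union>
             {(\<beta>, y). \<beta> \<in> F4_long \<and> y \<in> L \<and> F \<beta> \<in> H}"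

lemma twisted_short: "\<alpha> \<in> F4_short \<Longrightarrow> (\<alpha>, y) \<in> twisted \<longleftrightarrow> y - F \<alpha> \<in> H"
  using F4_short_not_long by (auto simp: twisted_def)

lemma twisted_long: "\<beta> \<in> F4_long \<Longrightarrow> (\<beta>, y) \<in> twisted \<longleftrightarrow> y \<in> L \<and> F \<beta> \<in> H"
  using F4_short_not_long by (auto simp: twisted_def)

lemma F_zero: "F 0 \<in> H"
  using F_add[of 0 0] additive_subgroup_zero[OF F4_lattice_subgroup]
    additive_subgroup_minus[OF H, of "- F 0"] by simp

lemma F_minus: 
  assumes "v \<in> F4_lattice"
  shows "F (- v) + F v \<in> H"
proof -
  have "F 0 - (F v + F (- v)) \<in> H"
    using F_add[OF assms, of "- v"] additive_subgroup_minus[OF F4_lattice_subgroup assms] by simp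
  from additive_subgroup_diff[OF H F_zero this] show ?thesis by (simp add: add.commute)
qed

lemma F_diff:
  assumes "v \<in> F4_lattice" "w \<in> F4_lattice"
  shows "F (v - w) - (F v - F w) \<in> H"
proof -
  have "F (v + - w) - (F v + F (- w)) \<in> H"
    using F_add[OF assms(1), of "- w"] additive_subgroup_minus[OF F4_lattice_subgroup assms(2)]
    by simp
  from additive_subgroup_add[OF H this F_minus[OF assms(2)]] show ?thesis
    by (simp add: algebra_simps)
qed

lemma F_scaleR_nat:
  assumes "v \<in> F4_lattice"
  shows "F (real n *\<^sub>R v) - real n *\<^sub>R F v \<in> H"
proof (induction n)
  case 0
  then show ?case by (simp add: F_zero)
next
  case (Suc n)
  have "F (real n *\<^sub>R v + v) - (F (real n *\<^sub>R v) + F v) \<in> H"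
    using F_add[OF _ assms, of "real n *\<^sub>R v"]
      additive_subgroup_scaleR_nat[OF F4_lattice_subgroup assms] by simp
  from additive_subgroup_add[OF H this Suc] show ?case by (simp add: algebra_simps)
qed

lemma F_scaleR_int:
  assumes "v \<in> F4_lattice" "c \<in> \<int>"
  shows "F (c *\<^sub>R v) - c *\<^sub>R F v \<in> H"
proof -
  obtain k :: int where k: "c = k" using assms(2) by (elim Ints_cases)
  show ?thesis
  proof (cases k rule: int_cases2)
    case (nonneg n)
    then show ?thesis using F_scaleR_nat[OF assms(1), of n] k by simp
  next
    case (nonpos n)
    have "F (- (real n *\<^sub>R v)) + F (real n *\<^sub>R v) \<in> H"
      by (rule F_minus) (rule additive_subgroup_scaleR_nat[OF F4_lattice_subgroup assms(1)])
    from additive_subgroup_diff[OF H this F_scaleR_nat[OF assms(1), of n]] show ?thesis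
      using nonpos k by simp
  qed
qed

text \<open>Reflecting a root subtracts an integral multiple of another, so this is the
  compatibility of \<tau> with reflections.\<close>

lemma F_diff_scaleR:
  assumes "v \<in> F4_lattice" "w \<in> F4_lattice" "c \<in> \<int>"
  shows "F (v - c *\<^sub>R w) - (F v - c *\<^sub>R F w) \<in> H"
proof -
  have "F (v - c *\<^sub>R w) - (F v - F (c *\<^sub>R w)) \<in> H"
    by (rule F_diff[OF assms(1)])
      (rule additive_subgroup_scaleR_int[OF F4_lattice_subgroup assms(2,3)])
  from additive_subgroup_diff[OF H this F_scaleR_int[OF assms(2,3)]] show ?thesis
    by (simp add: algebra_simps)
qed

lemma double_mem: "s \<in> S \<Longrightarrow> s + s \<in> H"
  using double L_sub_H by blast

lemma twisted_sub: "twisted \<subseteq> roots"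
proof
  fix a assume "a \<in> twisted"
  then consider \<alpha> y where "a = (\<alpha>, y)" "\<alpha> \<in> F4_short" "y - F \<alpha> \<in> H"
    | \<beta> y where "a = (\<beta>, y)" "\<beta> \<in> F4_long" "y \<in> L" by (auto simp: twisted_def)
  then show "a \<in> roots"
  proof cases
    case 1
    then have "(y - F \<alpha>) + F \<alpha> \<in> S"
      using H_sub F_mem F4_short_lattice by (intro additive_subgroup_add[OF S]) auto
    then show ?thesis using 1 roots_short by simp
  qed (simp add: roots_long)
qed

text \<open>Every element of \<open>twisted\<close> has second component congruent to
  \<open>F\<close> of its root modulo \<open>H\<close>, since over long roots both lie in
  \<open>H\<close>. The congruence is additive. If the sum is long, its second component lies in
  \<open>L \<subseteq> H\<close>, which forces \<open>F\<close> of the sum into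
  \<open>H\<close>.\<close>

lemma twisted_sum_closed: "sum_closed_in roots twisted"
  unfolding sum_closed_in_def
proof (intro ballI impI)
  fix a b assume "a \<in> twisted" "b \<in> twisted" and sum: "a + b \<in> roots"
  moreover obtain \<alpha> y \<gamma> z where ab: "a = (\<alpha>, y)" "b = (\<gamma>, z)" by (cases a, cases b)
  ultimately have mem: "(\<alpha>, y) \<in> twisted" "(\<gamma>, z) \<in> twisted" "(\<alpha> + \<gamma>, y + z) \<in> roots"
    by simp_all
  note Q = F4_short_lattice F4_long_lattice
  \<comment> \<open>Stated for arbitrary roots so that it can also be applied with the two summands
    exchanged.\<close>
  have key: "(\<alpha> + \<gamma>, y + z) \<in> twisted"
    if mem: "(\<alpha>, y) \<in> twisted" "(\<gamma>, z) \<in> twisted" "(\<alpha> + \<gamma>, y + z) \<in> roots"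
      and \<alpha>: "\<alpha> \<in> F4_short" for \<alpha> y \<gamma> z
  proof (cases "\<gamma> \<in> F4_short")
    case True
    have 1: "(y - F \<alpha>) + (z - F \<gamma>) \<in> H"
      using mem \<alpha> True by (intro additive_subgroup_add[OF H]) (simp_all add: twisted_short)
    have 2: "F (\<alpha> + \<gamma>) - (F \<alpha> + F \<gamma>) \<in> H" by (rule F_add; rule Q(1); fact)
    from additive_subgroup_diff[OF H 1 2] have 3: "(y + z) - F (\<alpha> + \<gamma>) \<in> H"
      by (simp add: algebra_simps)
    show ?thesis
    proof (cases "\<alpha> + \<gamma> \<in> F4_short")
      case False
      then have l: "\<alpha> + \<gamma> \<in> F4_long" "y + z \<in> L" using mem(3) by (auto simp: roots_def)
      then have "(y + z) - ((y + z) - F (\<alpha> + \<gamma>)) \<in> H"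
        using 3 L_sub_H by (intro additive_subgroup_diff[OF H _ 3]) auto
      then show ?thesis using l by (simp add: twisted_long)
    qed (simp add: twisted_short 3)
  next
    case False
    then have \<gamma>: "\<gamma> \<in> F4_long" "z \<in> L" "F \<gamma> \<in> H" using mem(2) by (auto simp: twisted_def)
    then have short: "\<alpha> + \<gamma> \<in> F4_short"
      using mem(3) short_plus_long_not_long[OF \<alpha>] by (auto simp: roots_def)
    have "F (\<alpha> + \<gamma>) - (F \<alpha> + F \<gamma>) \<in> H" by (rule F_add) (simp_all add: Q \<alpha> \<gamma>)
    moreover have "(y - F \<alpha>) + (z - F \<gamma>) \<in> H"
    proof (rule additive_subgroup_add[OF H])
      show "y - F \<alpha> \<in> H" using mem \<alpha> by (simp add: twisted_short)
      show "z - F \<gamma> \<in> H" using \<gamma> L_sub_H by (intro additive_subgroup_diff[OF H]) auto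
    qed
    ultimately have "((y - F \<alpha>) + (z - F \<gamma>)) - (F (\<alpha> + \<gamma>) - (F \<alpha> + F \<gamma>)) \<in> H"
      by (rule additive_subgroup_diff[OF H, rotated])
    then show ?thesis using short by (simp add: twisted_short algebra_simps)
  qed
  have "(\<alpha> + \<gamma>, y + z) \<in> twisted"
  proof (cases "\<alpha> \<in> F4_short \<or> \<gamma> \<in> F4_short")
    case True
    then show ?thesis using key[of \<alpha> y \<gamma> z] key[of \<gamma> z \<alpha> y] mem by (auto simp: add.commute)
  next
    case False
    then have *: "\<alpha> \<in> F4_long" "y \<in> L" "F \<alpha> \<in> H" "\<gamma> \<in> F4_long" "z \<in> L" "F \<gamma> \<in> H"
      using mem by (auto simp: twisted_def)
    then have l: "\<alpha> + \<gamma> \<in> F4_long" "y + z \<in> L"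
      using mem(3) long_plus_long_not_short[of \<alpha> \<gamma>] by (auto simp: roots_def)
    have "F (\<alpha> + \<gamma>) - (F \<alpha> + F \<gamma>) \<in> H" by (rule F_add) (simp_all add: Q *)
    from additive_subgroup_add[OF H this additive_subgroup_add[OF H *(3,6)]]
    have "F (\<alpha> + \<gamma>) \<in> H" by simp
    then show ?thesis using l by (simp add: twisted_long)
  qed
  then show "a + b \<in> twisted" by (simp add: ab)
qed

text \<open>For short \<open>\<beta>\<close> the congruence modulo \<open>H\<close> is preserved by
  linearity. For long \<open>\<beta>\<close> the new component must stay in \<open>L\<close> itself,
  so \<open>n *\<^sub>R y \<in> L\<close> has to be shown.\<close>

lemma twisted_refl:
  assumes "a \<in> twisted" "b \<in> twisted"
  shows "affine_refl a b \<in> twisted"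
proof -
  obtain \<alpha> y \<beta> z where ab: "a = (\<alpha>, y)" "b = (\<beta>, z)" by (cases a, cases b)
  define n where "n = \<beta> \<bullet> coroot \<alpha>"
  have mem: "(\<alpha>, y) \<in> twisted" "(\<beta>, z) \<in> twisted" using assms ab by simp_all
  then have F4: "\<alpha> \<in> F4" "\<beta> \<in> F4" by (auto simp: twisted_def F4_def)
  then have Q: "\<alpha> \<in> F4_lattice" "\<beta> \<in> F4_lattice"
    using F4_short_lattice F4_long_lattice by (auto simp: F4_def)
  have n: "n \<in> \<int>" unfolding n_def by (rule F4_integral[OF F4])
  have Fn: "F (\<beta> - n *\<^sub>R \<alpha>) - (F \<beta> - n *\<^sub>R F \<alpha>) \<in> H"
    by (rule F_diff_scaleR[OF Q(2,1) n])
  have r: "refl_root \<alpha> \<beta> = \<beta> - n *\<^sub>R \<alpha>" by (simp add: refl_root_def n_def)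
  then have r': "(\<beta> - n *\<^sub>R \<alpha>) \<bullet> (\<beta> - n *\<^sub>R \<alpha>) = \<beta> \<bullet> \<beta>" "\<beta> - n *\<^sub>R \<alpha> \<in> F4"
    using refl_root_inner[of \<alpha> \<beta>] refl_root_F4[OF F4] by simp_all
  have "(\<beta> - n *\<^sub>R \<alpha>, z - n *\<^sub>R y) \<in> twisted"
  proof (cases "\<beta> \<in> F4_short")
    case True
    have yn: "n *\<^sub>R (y - F \<alpha>) \<in> H"
    proof (rule additive_subgroup_scaleR_int[OF H _ n])
      show "y - F \<alpha> \<in> H"
        using mem(1) L_sub_H additive_subgroup_diff[OF H] by (auto simp: twisted_def)
    qed
    have "z - F \<beta> \<in> H" using mem(2) True by (simp add: twisted_short)
    from additive_subgroup_diff[OF H additive_subgroup_diff[OF H this yn] Fn]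
    have "(z - n *\<^sub>R y) - F (\<beta> - n *\<^sub>R \<alpha>) \<in> H" by (simp add: algebra_simps)
    moreover have "\<beta> - n *\<^sub>R \<alpha> \<in> F4_short"
      using r' True by (simp add: F4_shortI' F4_short_inner_self)
    ultimately show ?thesis by (simp add: twisted_short)
  next
    case False
    then have \<beta>: "\<beta> \<in> F4_long" "z \<in> L" "F \<beta> \<in> H" using mem(2) by (auto simp: twisted_def)
    have *: "n *\<^sub>R y \<in> L \<and> n *\<^sub>R F \<alpha> \<in> H"
    proof (cases "\<alpha> \<in> F4_short")
      case True
      \<comment> \<open>For short \<open>\<alpha>\<close> the integer \<open>n\<close> is even, so
        the multiples are integral multiples of doubles, which lie in \<open>L\<close> and
        \<open>H\<close>.\<close>
      have m: "\<alpha> \<bullet> \<beta> \<in> \<int>" "n *\<^sub>R v = (\<alpha> \<bullet> \<beta>) *\<^sub>R (v + v)" for v :: 'y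
        using inner_F4_long_Ints[of \<alpha> \<beta>] True \<beta>(1)
        by (simp_all add: n_def coroot_short inner_commute algebra_simps flip: scaleR_2)
      have "y \<in> S" using twisted_sub mem(1) roots_short[OF True] by blast
      then show ?thesis unfolding m(2)
        using True F_mem[OF Q(1)] double double_mem m(1)
        by (intro conjI additive_subgroup_scaleR_int[OF L] additive_subgroup_scaleR_int[OF H])
          simp_all
    next
      case False
      then show ?thesis using mem(1) n
        by (auto simp: twisted_def intro: additive_subgroup_scaleR_int[OF L] additive_subgroup_scaleR_int[OF H])
    qed
    from additive_subgroup_add[OF H Fn additive_subgroup_diff[OF H \<beta>(3) *[THEN conjunct2]]]
    have "F (\<beta> - n *\<^sub>R \<alpha>) \<in> H" by simp
    moreover have "\<beta> - n *\<^sub>R \<alpha> \<in> F4_long"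
      using r' \<beta>(1) by (simp add: F4_longI' F4_long_inner_self)
    moreover have "z - n *\<^sub>R y \<in> L" using * \<beta>(2) additive_subgroup_diff[OF L] by blast
    ultimately show ?thesis by (simp add: twisted_long)
  qed
  then show ?thesis by (simp add: affine_refl_def ab r n_def)
qed

end

section \<open>Nontrivial twists give maximal systems with semi-closed gradient\<close>

locale F4_nontrivial_twist = F4_twist S L H F
  for S L :: "'y::real_vector set" and H F +
  fixes \<beta>0 :: "real^4"
  assumes \<beta>0: "\<beta>0 \<in> F4_long" "F \<beta>0 \<notin> H"
begin

lemma closed_subroot_system_twisted: "closed_subroot_system roots twisted"
proof -
  have "(\<epsilon> 1, F (\<epsilon> 1)) \<in> twisted"
    using eps_in_F4_short additive_subgroup_zero[OF H] by (simp add: twisted_short)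
  moreover have "(\<beta>0, 0) \<in> roots - twisted"
    using \<beta>0 additive_subgroup_zero[OF L] by (simp add: roots_long twisted_long)
  ultimately show ?thesis
    unfolding closed_subroot_system_def subroot_system_def
    using twisted_sub twisted_refl twisted_sum_closed by blast
qed

lemma fst_twisted: "fst ` twisted = F4_short \<union> {\<beta> \<in> F4_long. F \<beta> \<in> H}"
proof
  show "fst ` twisted \<subseteq> F4_short \<union> {\<beta> \<in> F4_long. F \<beta> \<in> H}" by (auto simp: twisted_def)
  have "(\<alpha>, F \<alpha>) \<in> twisted" if "\<alpha> \<in> F4_short" for \<alpha>
    using that additive_subgroup_zero[OF H] by (simp add: twisted_short)
  moreover have "(\<beta>, 0) \<in> twisted" if "\<beta> \<in> F4_long" "F \<beta> \<in> H" for \<beta>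
    using that additive_subgroup_zero[OF L] by (simp add: twisted_long)
  ultimately show "F4_short \<union> {\<beta> \<in> F4_long. F \<beta> \<in> H} \<subseteq> fst ` twisted" by force
qed

text \<open>The root \<open>\<beta>0\<close> is a sum of two short roots but is absent, so the
  gradient is not closed. An absent sum is long; short plus long is never long, and long roots with
  \<open>F\<close> in \<open>H\<close> add up to such roots again, so both summands must be
  short.\<close>

lemma semi_closed_fst_twisted: "semi_closed F4 (fst ` twisted)"
proof -
  let ?G = "F4_short \<union> {\<beta> \<in> F4_long. F \<beta> \<in> H}"
  have "reflection_stable (fst ` twisted)"
    unfolding reflection_stable_def
  proof (intro ballI)
    fix \<alpha> \<beta> assume "\<alpha> \<in> fst ` twisted" "\<beta> \<in> fst ` twisted"
    then obtain a b where "a \<in> twisted" "b \<in> twisted" "\<alpha> = fst a" "\<beta> = fst b" by blast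
    then show "refl_root \<alpha> \<beta> \<in> fst ` twisted"
      using imageI[OF twisted_refl, of a b fst] by (simp add: affine_refl_def)
  qed
  moreover have "\<not> sum_closed_in F4 ?G"
  proof -
    obtain \<alpha> \<gamma> where "\<alpha> \<in> F4_short" "\<gamma> \<in> F4_short" "\<beta>0 = \<alpha> + \<gamma>"
      using F4_long_eq_sum[OF \<beta>0(1)] .
    then show ?thesis
      using \<beta>0 F4_short_not_long[of \<beta>0] by (auto simp: sum_closed_in_def F4_def)
  qed
  moreover have "\<alpha> \<in> F4_short \<and> \<beta> \<in> F4_short \<and> \<alpha> + \<beta> \<in> F4_long"
    if "\<alpha> \<in> ?G" "\<beta> \<in> ?G" "\<alpha> + \<beta> \<in> F4 - ?G" for \<alpha> \<beta>
  proof -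
    have long: "\<alpha> + \<beta> \<in> F4_long" "F (\<alpha> + \<beta>) \<notin> H" using that by (auto simp: F4_def)
    have "\<not> (\<alpha> \<in> F4_long \<and> \<beta> \<in> F4_long)"
    proof
      assume l: "\<alpha> \<in> F4_long \<and> \<beta> \<in> F4_long"
      then have "F \<alpha> \<in> H" "F \<beta> \<in> H" using that F4_short_not_long by blast+
      moreover have "F (\<alpha> + \<beta>) - (F \<alpha> + F \<beta>) \<in> H"
        using l by (simp add: F_add F4_long_lattice)
      ultimately have "(F (\<alpha> + \<beta>) - (F \<alpha> + F \<beta>)) + (F \<alpha> + F \<beta>) \<in> H"
        using additive_subgroup_add[OF H] by blast
      then show False using long by simp
    qed
    moreover have "\<not> (\<alpha> \<in> F4_short \<and> \<beta> \<in> F4_long)" "\<not> (\<alpha> \<in> F4_long \<and> \<beta> \<in> F4_short)"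
      using long(1) short_plus_long_not_long[of \<alpha> \<beta>] short_plus_long_not_long[of \<beta> \<alpha>]
      by (auto simp: add.commute)
    ultimately show ?thesis using that(1,2) long(1) by blast
  qed
  moreover have "?G \<subseteq> F4" by (auto simp: F4_def)
  ultimately show ?thesis
    unfolding semi_closed_def fst_twisted short_roots_F4 long_roots_F4 by blast
qed

lemma maximal_twisted:
  assumes index: "\<And>x y. x \<in> S \<Longrightarrow> x \<notin> H \<Longrightarrow> y \<in> S \<Longrightarrow> y \<notin> H \<Longrightarrow> y - x \<in> H"
  shows "maximal_closed_subroot_system roots twisted"
proof -
  have "\<Psi> = roots" if \<Psi>: "closed_subroot_system roots \<Psi>" "twisted \<subset> \<Psi>" for \<Psi>
  proof -
    note sum = closed_subroot_system_sum[OF \<Psi>(1)]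
    note sub = closed_subroot_system_sub[OF \<Psi>(1)]
    define full where "full \<alpha> \<longleftrightarrow> (\<forall>y\<in>S. (\<alpha>, y) \<in> \<Psi>)" for \<alpha>
    have F_self: "(\<alpha>, F \<alpha>) \<in> \<Psi>" "F \<alpha> \<in> S" if "\<alpha> \<in> F4_short" for \<alpha>
      using that \<Psi>(2) additive_subgroup_zero[OF H] twisted_short[of \<alpha> "F \<alpha>"]
        F_mem[OF F4_short_lattice] by auto
    have full_minus: "full (- \<alpha>)" if "full \<alpha>" for \<alpha>
      unfolding full_def
    proof
      fix y assume "y \<in> S"
      then have "(\<alpha>, - y) \<in> \<Psi>" using that additive_subgroup_minus[OF S] by (simp add: full_def)
      then show "(- \<alpha>, y) \<in> \<Psi>" using closed_subroot_system_minus[OF \<Psi>(1)] by fastforce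
    qed
    \<comment> \<open>Over \<open>\<gamma> = (\<gamma> - \<alpha>) + \<alpha>\<close>, the point
      \<open>F (\<gamma> - \<alpha>)\<close> over the first summand is completed by the full fibre
      over the second.\<close>
    have step_pos: "full \<gamma>"
      if \<alpha>: "\<alpha> \<in> F4_short" "full \<alpha>" and \<gamma>: "\<gamma> \<in> F4_short" "\<gamma> \<bullet> \<alpha> = 1/2" for \<alpha> \<gamma>
      unfolding full_def
    proof
      fix y assume y: "y \<in> S"
      have d: "\<gamma> - \<alpha> \<in> F4_short" using \<gamma> \<alpha> by (simp add: short_minus_short_short)
      have "y - F (\<gamma> - \<alpha>) \<in> S" by (rule additive_subgroup_diff[OF S y F_self(2)[OF d]])
      then have "(\<alpha>, y - F (\<gamma> - \<alpha>)) \<in> \<Psi>" using \<alpha>(2) by (simp add: full_def)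
      from sum[OF F_self(1)[OF d] this] show "(\<gamma>, y) \<in> \<Psi>"
        using \<gamma>(1) y by (simp add: roots_short)
    qed
    have step: "full \<gamma>" if "\<alpha> \<in> F4_short" "\<gamma> \<in> F4_short" "full \<alpha>" "\<bar>\<alpha> \<bullet> \<gamma>\<bar> = 1/2" for \<alpha> \<gamma>
      using step_pos[of \<alpha> \<gamma>] step_pos[of "- \<alpha>" \<gamma>] full_minus[of \<alpha>] that
      by (auto simp: F4_minus inner_commute abs_if split: if_splits)
    \<comment> \<open>A new point over \<open>\<alpha>\<close> lies in the other coset of
      \<open>H\<close>. Adding to it the twisted fibre over \<open>\<gamma> - \<alpha>\<close>
      produces the missing coset over the neighbour \<open>\<gamma>\<close>.\<close>
    have seed: "\<exists>\<gamma>\<in>F4_short. full \<gamma>"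
      if \<alpha>: "\<alpha> \<in> F4_short" and y: "(\<alpha>, y) \<in> \<Psi>" "(\<alpha>, y) \<notin> twisted" for \<alpha> y
    proof -
      obtain \<gamma> where \<gamma>: "\<gamma> \<in> F4_short" "\<alpha> \<bullet> \<gamma> = 1/2" using F4_short_ex_neighbour[OF \<alpha>] .
      have d: "\<gamma> - \<alpha> \<in> F4_short" using \<gamma> \<alpha> by (simp add: short_minus_short_short inner_commute)
      have yS: "y \<in> S" using sub y(1) roots_short[OF \<alpha>] by blast
      have yF: "y - F \<alpha> \<in> S" "y - F \<alpha> \<notin> H"
        using additive_subgroup_diff[OF S yS F_self(2)[OF \<alpha>]] y(2) twisted_short[OF \<alpha>] by simp_all
      have "(\<gamma>, w) \<in> \<Psi>" if w: "w \<in> S" for w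
      proof (cases "w - F \<gamma> \<in> H")
        case True
        then show ?thesis using twisted_short[OF \<gamma>(1)] \<Psi>(2) by blast
      next
        case False
        have "w - F \<gamma> \<in> S" by (rule additive_subgroup_diff[OF S w F_self(2)[OF \<gamma>(1)]])
        then have 1: "(w - F \<gamma>) - (y - F \<alpha>) \<in> H" using index yF False by blast
        have 2: "F (\<gamma> - \<alpha>) - (F \<gamma> - F \<alpha>) \<in> H"
          using F_diff F4_short_lattice \<gamma>(1) \<alpha> by simp
        from additive_subgroup_diff[OF H 1 2] have "(w - y) - F (\<gamma> - \<alpha>) \<in> H"
          by (simp add: algebra_simps)
        then have "(\<gamma> - \<alpha>, w - y) \<in> \<Psi>" using twisted_short[OF d] \<Psi>(2) by blast
        from sum[OF this y(1)] show ?thesis using \<gamma>(1) w by (simp add: roots_short)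
      qed
      then show ?thesis using \<gamma>(1) by (auto simp: full_def)
    qed
    obtain \<beta> y where new: "(\<beta>, y) \<in> \<Psi>" "(\<beta>, y) \<notin> twisted" using \<Psi>(2) by auto
    have "\<exists>\<gamma>\<in>F4_short. full \<gamma>"
    proof (cases "\<beta> \<in> F4_short")
      case False
      \<comment> \<open>For a new long root, subtracting the twisted point over one short summand
        leaves a short root. That root is again new, since otherwise \<open>F \<beta>\<close> would
        lie in \<open>H\<close>.\<close>
      then have \<beta>: "\<beta> \<in> F4_long" "y \<in> L" using new sub by (auto simp: roots_def)
      then have FH: "F \<beta> \<notin> H" using new twisted_long by blast
      obtain \<alpha> \<gamma> where \<alpha>: "\<alpha> \<in> F4_short" "\<gamma> \<in> F4_short" "\<beta> = \<alpha> + \<gamma>"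
        using F4_long_eq_sum[OF \<beta>(1)] .
      have "y - F \<alpha> \<in> S"
        using \<beta>(2) L_sub F_self(2)[OF \<alpha>(1)] by (intro additive_subgroup_diff[OF S]) auto
      moreover have "(- \<alpha>, - F \<alpha>) \<in> \<Psi>"
        by (rule closed_subroot_system_minus[OF \<Psi>(1) F_self(1)[OF \<alpha>(1)]])
      ultimately have "(\<gamma>, y - F \<alpha>) \<in> \<Psi>"
        using sum[of "(- \<alpha>, - F \<alpha>)" "(\<beta>, y)"] new(1) \<alpha> by (simp add: roots_short)
      moreover have "(\<gamma>, y - F \<alpha>) \<notin> twisted"
      proof
        assume "(\<gamma>, y - F \<alpha>) \<in> twisted"
        then have 1: "(y - F \<alpha>) - F \<gamma> \<in> H" using twisted_short[OF \<alpha>(2)] by blast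
        have 2: "F \<beta> - (F \<alpha> + F \<gamma>) \<in> H"
          unfolding \<alpha>(3) by (rule F_add; rule F4_short_lattice; fact)
        have 3: "y \<in> H" using \<beta>(2) L_sub_H by blast
        from additive_subgroup_add[OF H additive_subgroup_diff[OF H 2 1] 3]
        show False using FH by (simp add: algebra_simps)
      qed
      ultimately show ?thesis using seed[OF \<alpha>(2)] by blast
    qed (use seed new in blast)
    then obtain \<gamma>0 where "\<gamma>0 \<in> F4_short" "full \<gamma>0" by blast
    then have full: "full \<alpha>" if "\<alpha> \<in> F4_short" for \<alpha>
      using F4_short_connected[of \<gamma>0 full \<alpha>] step that by blast
    have "(\<beta>, y) \<in> \<Psi>" if \<beta>: "\<beta> \<in> F4_long" "y \<in> L" for \<beta> y
    proof -
      obtain \<alpha> \<gamma> where \<alpha>: "\<alpha> \<in> F4_short" "\<gamma> \<in> F4_short" "\<beta> = \<alpha> + \<gamma>"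
        using F4_long_eq_sum[OF \<beta>(1)] .
      have "(\<alpha>, 0) \<in> \<Psi>" "(\<gamma>, y) \<in> \<Psi>"
        using full[OF \<alpha>(1)] full[OF \<alpha>(2)] \<beta>(2) L_sub additive_subgroup_zero[OF S]
        by (auto simp: full_def)
      from sum[OF this] show ?thesis using \<alpha>(3) \<beta> by (simp add: roots_long)
    qed
    then have "roots \<subseteq> \<Psi>" using full by (auto simp: roots_def full_def)
    then show ?thesis using sub by blast
  qed
  then show ?thesis
    unfolding maximal_closed_subroot_system_def using closed_subroot_system_twisted by blast
qed

end

section \<open>Semi-closed gradients\<close>

lemma coroot_int_bounds:
  assumes "\<alpha> \<in> F4" "\<beta> \<in> F4"
  shows "\<beta> \<bullet> coroot \<alpha> = -2 \<or> \<beta> \<bullet> coroot \<alpha> = -1 \<or> \<beta> \<bullet> coroot \<alpha> = 0 \<or>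
         \<beta> \<bullet> coroot \<alpha> = 1 \<or> \<beta> \<bullet> coroot \<alpha> = 2"
  using assms inner_short_short[of \<beta> \<alpha>] inner_short_long[of \<alpha> \<beta>] inner_short_long[of \<beta> \<alpha>]
    inner_long_long[of \<beta> \<alpha>]
  by (auto simp: F4_def coroot_short coroot_long inner_commute)

text \<open>Replacing \<open>\<alpha>\<close> by \<open>- \<alpha>\<close> if necessary, the coroot
  pairing is 0, 1 or 2, and the reflection subtracts \<open>\<alpha>\<close> that many times. In the
  last case \<open>\<beta> - \<alpha>\<close> has squared length 0 or 1, so either
  \<open>\<beta> = \<alpha>\<close> or the intermediate vector is a root.\<close>

lemma reflection_stable_if_sum_closed:
  assumes C: "C \<subseteq> F4" "sum_closed_in F4 C" and minus: "\<And>\<alpha>. \<alpha> \<in> C \<Longrightarrow> - \<alpha> \<in> C"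
  shows "reflection_stable C"
proof -
  have add: "\<alpha> + \<beta> \<in> C" if "\<alpha> \<in> C" "\<beta> \<in> C" "\<alpha> + \<beta> \<in> F4" for \<alpha> \<beta>
    using C(2) that by (simp add: sum_closed_in_def)
  have pos: "refl_root \<alpha> \<beta> \<in> C" if \<alpha>: "\<alpha> \<in> C" and \<beta>: "\<beta> \<in> C" and "\<beta> \<bullet> coroot \<alpha> \<ge> 0" for \<alpha> \<beta>
  proof -
    have F4: "\<alpha> \<in> F4" "\<beta> \<in> F4" "refl_root \<alpha> \<beta> \<in> F4" using \<alpha> \<beta> C(1) refl_root_F4 by blast+
    have "\<beta> \<bullet> coroot \<alpha> = 0 \<or> \<beta> \<bullet> coroot \<alpha> = 1 \<or> \<beta> \<bullet> coroot \<alpha> = 2"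
      using coroot_int_bounds[OF F4(1,2)] that(3) by auto
    then consider "\<beta> \<bullet> coroot \<alpha> = 0" | "\<beta> \<bullet> coroot \<alpha> = 1" | "\<beta> \<bullet> coroot \<alpha> = 2"
      by blast
    then show ?thesis
    proof cases
      case 1
      then show ?thesis using \<beta> by (simp add: refl_root_def)
    next
      case 2
      then show ?thesis using add[OF \<beta> minus[OF \<alpha>]] F4(3) by (simp add: refl_root_def)
    next
      case 3
      have sq: "\<alpha> \<bullet> \<alpha> = 1 \<or> \<alpha> \<bullet> \<alpha> = 2" "\<beta> \<bullet> \<beta> = 1 \<or> \<beta> \<bullet> \<beta> = 2"
        using F4 by (auto simp: F4_iff)
      then have "\<beta> \<bullet> \<alpha> = \<alpha> \<bullet> \<alpha>" using 3 by (auto simp: coroot_def)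
      then have n: "(\<beta> - \<alpha>) \<bullet> (\<beta> - \<alpha>) = \<beta> \<bullet> \<beta> - \<alpha> \<bullet> \<alpha>"
        by (simp add: inner_diff_left inner_diff_right inner_commute)
      have "(\<beta> - \<alpha>) \<bullet> (\<beta> - \<alpha>) = 0 \<or> (\<beta> - \<alpha>) \<bullet> (\<beta> - \<alpha>) = 1"
        using n sq inner_ge_zero[of "\<beta> - \<alpha>"] by auto
      then show ?thesis
      proof
        assume "(\<beta> - \<alpha>) \<bullet> (\<beta> - \<alpha>) = 0"
        then have "\<beta> = \<alpha>" by simp
        then show ?thesis using 3 minus[OF \<alpha>] by (simp add: refl_root_def scaleR_2)
      next
        assume "(\<beta> - \<alpha>) \<bullet> (\<beta> - \<alpha>) = 1"
        then have "\<beta> + - \<alpha> \<in> F4"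
          using F4(1,2) in_lat_diff_int[of \<beta> \<alpha> 1] by (simp add: F4_iff)
        from add[OF add[OF \<beta> minus[OF \<alpha>] this] minus[OF \<alpha>]] show ?thesis
          using 3 F4(3) by (simp add: refl_root_def scaleR_2 algebra_simps)
      qed
    qed
  qed
  show ?thesis
    unfolding reflection_stable_def
  proof (intro ballI)
    fix \<alpha> \<beta> assume *: "\<alpha> \<in> C" "\<beta> \<in> C"
    have "refl_root (- \<alpha>) \<beta> = refl_root \<alpha> \<beta>" using refl_root_scale[of "-1" \<alpha> \<beta>] by simp
    moreover have "\<beta> \<bullet> coroot (- \<alpha>) = - (\<beta> \<bullet> coroot \<alpha>)" by (simp add: coroot_def)
    ultimately show "refl_root \<alpha> \<beta> \<in> C"
      using pos[OF *] pos[OF minus[OF *(1)] *(2)] by (cases "\<beta> \<bullet> coroot \<alpha> \<ge> 0") auto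
  qed
qed

text \<open>
  \<open>C\<close> arises by adding the long sums of two short roots of \<open>G\<close>; a sum involving a new root
  \<open>\<alpha> + \<beta>\<close> is evaluated by first adding the other summand to \<open>\<alpha>\<close> or to \<open>\<beta>\<close>.
\<close>

lemma semi_closed_hull:
  assumes G: "semi_closed F4 G"
  obtains C where "G \<subseteq> C" "C \<subseteq> F4" "sum_closed_in F4 C" "reflection_stable C"
    "C \<inter> F4_short = G \<inter> F4_short"
proof -
  have GF: "G \<subseteq> F4" and refl: "\<And>\<alpha> \<beta>. \<alpha> \<in> G \<Longrightarrow> \<beta> \<in> G \<Longrightarrow> refl_root \<alpha> \<beta> \<in> G"
    and semi: "\<And>\<alpha> \<beta>. \<alpha> \<in> G \<Longrightarrow> \<beta> \<in> G \<Longrightarrow> \<alpha> + \<beta> \<in> F4 - G \<Longrightarrow>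
       \<alpha> \<in> F4_short \<and> \<beta> \<in> F4_short \<and> \<alpha> + \<beta> \<in> F4_long"
    using G unfolding semi_closed_def reflection_stable_def short_roots_F4 long_roots_F4 by blast+
  define T where "T = {\<gamma> \<in> F4_long. \<exists>\<alpha> \<beta>. \<alpha> \<in> G \<inter> F4_short \<and> \<beta> \<in> G \<inter> F4_short \<and> \<gamma> = \<alpha> + \<beta>}"
  have minus: "- \<alpha> \<in> G" if "\<alpha> \<in> G" for \<alpha>
  proof -
    have "\<alpha> \<noteq> 0" using that GF by (auto simp: F4_iff)
    then have "refl_root \<alpha> \<alpha> = - \<alpha>" by (simp add: refl_root_def coroot_def scaleR_2)
    then show ?thesis using refl[OF that that] by simp
  qed
  have to_short: "\<alpha> + \<beta> \<in> G" if "\<alpha> \<in> G" "\<beta> \<in> G" "\<alpha> + \<beta> \<in> F4_short" for \<alpha> \<beta>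
    using semi[OF that(1,2)] that(3) F4_short_not_long by (auto simp: F4_def)
  have to_long: "\<alpha> + \<beta> \<in> T" if "\<alpha> \<in> G \<inter> F4_short" "\<beta> \<in> G \<inter> F4_short" "\<alpha> + \<beta> \<in> F4_long" for \<alpha> \<beta>
    using that unfolding T_def by blast
  \<comment> \<open>With \<open>\<gamma> = \<alpha> + \<beta>\<close> the inner products of
    \<open>\<delta>\<close> with \<open>\<alpha>\<close> and \<open>\<beta>\<close> sum to -1.
    Either \<open>\<delta>\<close> cancels a summand, or both are -1/2 and
    \<open>\<alpha> + \<delta>\<close> is a short root of \<open>G\<close>, to which
    \<open>\<beta>\<close> is added.\<close>
  have T_short: "\<gamma> + \<delta> \<in> G" if \<gamma>: "\<gamma> \<in> T" and \<delta>: "\<delta> \<in> G \<inter> F4_short" "\<gamma> + \<delta> \<in> F4_short" for \<gamma> \<delta>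
  proof -
    obtain \<alpha> \<beta> where ab: "\<alpha> \<in> G \<inter> F4_short" "\<beta> \<in> G \<inter> F4_short" "\<gamma> = \<alpha> + \<beta>" "\<gamma> \<in> F4_long"
      using \<gamma> unfolding T_def by blast
    have "\<delta> \<bullet> \<gamma> = -1"
      using \<delta> ab(4) short_plus_long_short[of \<delta> \<gamma>] by (simp add: add.commute)
    then have s: "\<alpha> \<bullet> \<delta> + \<beta> \<bullet> \<delta> = -1" by (simp add: ab(3) inner_add_right inner_commute)
    have "\<alpha> \<bullet> \<delta> = -1 \<or> \<beta> \<bullet> \<delta> = -1 \<or> \<alpha> \<bullet> \<delta> = -1/2"
    proof -
      have "-1 \<le> \<beta> \<bullet> \<delta>" using inner_short_short[of \<beta> \<delta>] ab(2) \<delta>(1) by auto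
      moreover have "\<beta> \<bullet> \<delta> = -1 - \<alpha> \<bullet> \<delta>" using s by simp
      ultimately show ?thesis using inner_short_short[of \<alpha> \<delta>] ab(1) \<delta>(1) by auto
    qed
    moreover have "\<delta> = - \<alpha>" if "\<alpha> \<bullet> \<delta> = -1"
      using inner_min_imp_minus[of \<alpha> \<delta>] that ab(1) \<delta>(1) by (simp add: F4_short_inner_self)
    moreover have "\<delta> = - \<beta>" if "\<beta> \<bullet> \<delta> = -1"
      using inner_min_imp_minus[of \<beta> \<delta>] that ab(2) \<delta>(1) by (simp add: F4_short_inner_self)
    ultimately consider "\<delta> = - \<alpha>" | "\<delta> = - \<beta>" | "\<alpha> \<bullet> \<delta> = -1/2"
      by blast
    then show ?thesis
    proof cases
      case 3
      then have "\<alpha> + \<delta> \<in> G"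
        using ab \<delta> by (intro to_short) (simp_all add: short_plus_short_short)
      then show ?thesis
        using to_short[of "\<alpha> + \<delta>" \<beta>] ab \<delta> by (simp add: algebra_simps)
    qed (use ab in simp_all)
  qed
  have T_long_aux: "\<gamma> + \<delta> \<in> T"
    if \<gamma>: "\<alpha> \<in> G \<inter> F4_short" "\<beta> \<in> G \<inter> F4_short" "\<alpha> + \<beta> + \<delta> \<in> F4_long" "\<gamma> = \<alpha> + \<beta>"
      and short: "\<alpha> + \<delta> \<in> G \<inter> F4_short" for \<gamma> \<alpha> \<beta> \<delta>
    using to_long[OF short \<gamma>(2)] \<gamma>(3,4) by (simp add: algebra_simps)
  \<comment> \<open>Short roots have inner product -1, 0 or 1 with a long root, so some summand of
    \<open>\<gamma>\<close> becomes another short root when \<open>\<delta>\<close> is added to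
    it.\<close>
  have inner_split: "\<alpha> \<bullet> \<delta> = -1 \<or> \<beta> \<bullet> \<delta> = -1"
    if "\<alpha> \<in> F4_short" "\<beta> \<in> F4_short" "\<delta> \<in> F4_long" "(\<alpha> + \<beta>) \<bullet> \<delta> = -1" for \<alpha> \<beta> \<delta>
  proof -
    have "\<beta> \<bullet> \<delta> = -1 - \<alpha> \<bullet> \<delta>" using that(4) by (simp add: inner_add_left)
    then show ?thesis
      using inner_short_long[OF that(1,3)] inner_short_long[OF that(2,3)] by auto
  qed
  have short_add: "\<alpha> + \<delta> \<in> G \<inter> F4_short"
    if "\<alpha> \<in> G \<inter> F4_short" "\<delta> \<in> F4_long" "\<delta> \<in> G \<union> T" "\<alpha> \<bullet> \<delta> = -1" for \<alpha> \<delta>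
  proof -
    have "\<alpha> + \<delta> \<in> F4_short" using that short_plus_long_short[of \<alpha> \<delta>] by simp
    then show ?thesis using that to_short[of \<alpha> \<delta>] T_short[of \<delta> \<alpha>] by (auto simp: add.commute)
  qed
  have T_long: "\<gamma> + \<delta> \<in> T" if \<gamma>: "\<gamma> \<in> T" and \<delta>: "\<delta> \<in> F4_long" "\<delta> \<in> G \<union> T" "\<gamma> + \<delta> \<in> F4_long" for \<gamma> \<delta>
  proof -
    obtain \<alpha> \<beta> where ab: "\<alpha> \<in> G \<inter> F4_short" "\<beta> \<in> G \<inter> F4_short" "\<gamma> = \<alpha> + \<beta>" "\<gamma> \<in> F4_long"
      using \<gamma> unfolding T_def by blast
    have "\<gamma> \<bullet> \<delta> = -1" using long_plus_long_long[OF ab(4) \<delta>(1)] \<delta>(3) by simp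
    then have "\<alpha> \<bullet> \<delta> = -1 \<or> \<beta> \<bullet> \<delta> = -1" using inner_split[of \<alpha> \<beta> \<delta>] ab \<delta>(1) by simp
    then show ?thesis
    proof
      assume "\<alpha> \<bullet> \<delta> = -1"
      then have "\<alpha> + \<delta> \<in> G \<inter> F4_short" using short_add ab(1) \<delta> by blast
      then show ?thesis using T_long_aux[of \<alpha> \<beta> \<delta> \<gamma>] ab \<delta>(3) by simp
    next
      assume "\<beta> \<bullet> \<delta> = -1"
      then have "\<beta> + \<delta> \<in> G \<inter> F4_short" using short_add ab(2) \<delta> by blast
      then show ?thesis using T_long_aux[of \<beta> \<alpha> \<delta> \<gamma>] ab \<delta>(3) by (simp add: add.commute)
    qed
  qed
  have TL: "T \<subseteq> F4_long" by (auto simp: T_def)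
  have T_add: "\<gamma> + \<delta> \<in> G \<union> T" if "\<gamma> \<in> T" "\<delta> \<in> G \<union> T" "\<gamma> + \<delta> \<in> F4" for \<gamma> \<delta>
  proof (cases "\<delta> \<in> F4_short")
    case True
    have \<gamma>: "\<gamma> \<in> F4_long" using that(1) TL by blast
    have "\<delta> \<in> G" using True that(2) TL F4_short_not_long by blast
    moreover have "\<gamma> + \<delta> \<in> F4_short"
      using short_plus_long_not_long[OF True \<gamma>] that(3) by (auto simp: F4_def add.commute)
    ultimately show ?thesis using T_short[OF that(1)] True by blast
  next
    case False
    then have \<delta>: "\<delta> \<in> F4_long" using that(2) TL GF by (auto simp: F4_def)
    have \<gamma>: "\<gamma> \<in> F4_long" using that(1) TL by blast
    then have "\<gamma> + \<delta> \<in> F4_long"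
      using long_plus_long_not_short[OF \<gamma> \<delta>] that(3) by (auto simp: F4_def)
    then show ?thesis using T_long[OF that(1) \<delta> that(2)] by blast
  qed
  have add: "\<gamma> + \<delta> \<in> G \<union> T" if "\<gamma> \<in> G \<union> T" "\<delta> \<in> G \<union> T" "\<gamma> + \<delta> \<in> F4" for \<gamma> \<delta>
  proof (cases "\<gamma> \<in> G \<and> \<delta> \<in> G")
    case True
    then show ?thesis using semi[of \<gamma> \<delta>] to_long[of \<gamma> \<delta>] that(3) by blast
  next
    case False
    then show ?thesis using T_add[of \<gamma> \<delta>] T_add[of \<delta> \<gamma>] that by (auto simp: add.commute)
  qed
  have "- \<gamma> \<in> T" if \<gamma>: "\<gamma> \<in> T" for \<gamma>
  proof -
    obtain \<alpha> \<beta> where ab: "\<alpha> \<in> G \<inter> F4_short" "\<beta> \<in> G \<inter> F4_short" "\<gamma> = \<alpha> + \<beta>" "\<gamma> \<in> F4_long"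
      using \<gamma> unfolding T_def by blast
    then have "- \<alpha> + - \<beta> \<in> F4_long" using F4_minus(2)[of \<gamma>] by simp
    then show ?thesis using to_long[of "- \<alpha>" "- \<beta>"] ab minus by (simp add: F4_minus)
  qed
  then have minus': "- \<gamma> \<in> G \<union> T" if "\<gamma> \<in> G \<union> T" for \<gamma> using minus that by blast
  have sub: "G \<union> T \<subseteq> F4" using GF TL by (auto simp: F4_def)
  have closed: "sum_closed_in F4 (G \<union> T)" using add by (simp add: sum_closed_in_def)
  show thesis
  proof (rule that)
    show "G \<subseteq> G \<union> T" by blast
    show "(G \<union> T) \<inter> F4_short = G \<inter> F4_short" using TL F4_short_not_long by blast
    show "reflection_stable (G \<union> T)"
      by (rule reflection_stable_if_sum_closed[OF sub closed minus'])
  qed (fact sub closed)+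
qed

context F4_pair
begin

text \<open>The real roots are themselves the twisted system for \<open>H = S\<close> and
  \<open>F = 0\<close>, so \<open>twisted_refl\<close> applies.\<close>

lemma affine_refl_roots:
  assumes "a \<in> roots" "b \<in> roots"
  shows "affine_refl a b \<in> roots"
proof -
  interpret F4_twist S L S "\<lambda>_. 0"
    by unfold_locales (simp_all add: S L_sub additive_subgroup_zero[OF S])
  have "twisted = roots"
    by (auto simp: twisted_def roots_def additive_subgroup_zero[OF S])
  then show ?thesis using twisted_refl assms by simp
qed

lemma roots_zero: "\<alpha> \<in> F4 \<Longrightarrow> (\<alpha>, 0) \<in> roots"
  using additive_subgroup_zero[OF S] additive_subgroup_zero[OF L] by (auto simp: roots_def F4_def)

text \<open>The hull \<open>C\<close> has the same short roots as the gradient, so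
  \<open>C = F4\<close> suffices. Otherwise the set of all real roots over \<open>C\<close> equals
  \<open>\<Psi>\<close> by maximality, and the gradient would be closed.\<close>

lemma maximal_semi_closed_imp_short:
  assumes max: "maximal_closed_subroot_system roots \<Psi>" and semi: "semi_closed F4 (fst ` \<Psi>)"
  shows "F4_short \<subseteq> fst ` \<Psi>"
proof -
  obtain C where C: "fst ` \<Psi> \<subseteq> C" "C \<subseteq> F4" "sum_closed_in F4 C" "reflection_stable C"
    "C \<inter> F4_short = fst ` \<Psi> \<inter> F4_short"
    using semi_closed_hull[OF semi] .
  have closed: "closed_subroot_system roots \<Psi>"
    using max by (simp add: maximal_closed_subroot_system_def)
  have "C = F4"
  proof (rule ccontr)
    assume "C \<noteq> F4"
    then obtain \<alpha>0 where \<alpha>0: "\<alpha>0 \<in> F4" "\<alpha>0 \<notin> C" using C(2) by blast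
    let ?R = "{a \<in> roots. fst a \<in> C}"
    have sub: "\<Psi> \<subseteq> ?R" using closed_subroot_system_sub[OF closed] C(1) by auto
    have "sum_closed_in roots ?R"
      using C(3) roots_F4 by (fastforce simp: sum_closed_in_def)
    moreover have "affine_refl a b \<in> ?R" if "a \<in> ?R" "b \<in> ?R" for a b
      using that affine_refl_roots[of a b] C(4) by (simp add: reflection_stable_def affine_refl_def)
    moreover have "\<Psi> \<noteq> {}"
      using closed by (simp add: closed_subroot_system_def subroot_system_def)
    then have "?R \<noteq> {}" using sub by blast
    moreover have "(\<alpha>0, 0) \<in> roots - ?R" using \<alpha>0 roots_zero by simp
    ultimately have R: "closed_subroot_system roots ?R" "?R \<subset> roots"
      unfolding closed_subroot_system_def subroot_system_def by blast+
    then have "\<Psi> = ?R" using max sub unfolding maximal_closed_subroot_system_def by blast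
    moreover have "fst ` ?R = C"
    proof
      show "C \<subseteq> fst ` ?R"
      proof
        fix \<alpha> assume "\<alpha> \<in> C"
        then have "(\<alpha>, 0) \<in> ?R" using roots_zero C(2) by auto
        then show "\<alpha> \<in> fst ` ?R" by force
      qed
    qed auto
    ultimately have "sum_closed_in F4 (fst ` \<Psi>)" using C(3) by simp
    then show False using semi by (simp add: semi_closed_def)
  qed
  then show ?thesis using C(5) by (auto simp: F4_def)
qed

end

section \<open>Maximal closed subroot systems with semi-closed gradient are twisted\<close>

context F4_pair
begin

lemma maximal_semi_closed_imp_twisted:
  assumes max: "maximal_closed_subroot_system roots \<Psi>" and semi: "semi_closed F4 (fst ` \<Psi>)"
  obtains H F \<beta>0 where "F4_nontrivial_twist S L H F \<beta>0" "\<Psi> = F4_twist.twisted L H F"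
    "\<And>x y. x \<in> S \<Longrightarrow> x \<notin> H \<Longrightarrow> y \<in> S \<Longrightarrow> y \<notin> H \<Longrightarrow> y - x \<in> H"
proof -
  have closed: "closed_subroot_system roots \<Psi>"
    using max by (simp add: maximal_closed_subroot_system_def)
  note sum = closed_subroot_system_sum[OF closed]
  note sub = closed_subroot_system_sub[OF closed]
  note minus = closed_subroot_system_minus[OF closed]
  have short: "\<exists>y. (\<alpha>, y) \<in> \<Psi>" if "\<alpha> \<in> F4_short" for \<alpha>
    using maximal_semi_closed_imp_short[OF max semi] that by force
  have mem_S: "y \<in> S" if "(\<alpha>, y) \<in> \<Psi>" for \<alpha> y
    using that sub roots_F4 by blast
  have sum_short: "(\<alpha> + \<gamma>, y + z) \<in> \<Psi>"
    if "(\<alpha>, y) \<in> \<Psi>" "(\<gamma>, z) \<in> \<Psi>" "\<alpha> + \<gamma> \<in> F4_short" for \<alpha> \<gamma> y z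
    using sum[OF that(1,2)] that(3) mem_S[OF that(1)] mem_S[OF that(2)]
    by (simp add: roots_short additive_subgroup_add[OF S])

  \<comment> \<open>The fibres of \<open>\<Psi>\<close> over the short roots are cosets of \<open>K\<close>.\<close>
  define K where "K = {d. \<forall>\<alpha>\<in>F4_short. \<forall>z. (\<alpha>, z) \<in> \<Psi> \<longrightarrow> (\<alpha>, z + d) \<in> \<Psi>}"
  \<comment> \<open>Add the point \<open>y\<close> over \<open>\<alpha>\<close> and the negative of
    the point \<open>y'\<close>, in the order for which the intermediate root is short.\<close>
  have translate: "(\<gamma>, z + (y - y')) \<in> \<Psi>"
    if \<alpha>: "\<alpha> \<in> F4_short" "(\<alpha>, y) \<in> \<Psi>" "(\<alpha>, y') \<in> \<Psi>"
      and \<gamma>: "\<gamma> \<in> F4_short" "(\<gamma>, z) \<in> \<Psi>" and "\<bar>\<alpha> \<bullet> \<gamma>\<bar> = 1/2" for \<alpha> \<gamma> y y' z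
  proof -
    have "\<alpha> \<bullet> \<gamma> = 1/2 \<or> \<alpha> \<bullet> \<gamma> = -1/2" using that(6) by (auto simp: abs_if split: if_splits)
    then show ?thesis
    proof
      assume "\<alpha> \<bullet> \<gamma> = 1/2"
      then have "\<gamma> + - \<alpha> \<in> F4_short"
        using \<alpha>(1) \<gamma>(1) by (simp add: short_minus_short_short inner_commute)
      from sum_short[OF sum_short[OF \<gamma>(2) minus[OF \<alpha>(3)] this] \<alpha>(2)]
      show ?thesis using \<gamma>(1) by (simp add: algebra_simps)
    next
      assume "\<alpha> \<bullet> \<gamma> = -1/2"
      then have "\<gamma> + \<alpha> \<in> F4_short"
        using \<alpha>(1) \<gamma>(1) by (simp add: short_plus_short_short inner_commute)
      from sum_short[OF sum_short[OF \<gamma>(2) \<alpha>(2) this] minus[OF \<alpha>(3)]]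
      show ?thesis using \<gamma>(1) by (simp add: algebra_simps)
    qed
  qed
  have diff_K: "y - y' \<in> K" if \<alpha>: "\<alpha> \<in> F4_short" "(\<alpha>, y) \<in> \<Psi>" "(\<alpha>, y') \<in> \<Psi>" for \<alpha> y y'
  proof -
    let ?P = "\<lambda>\<gamma>. \<forall>z. (\<gamma>, z) \<in> \<Psi> \<longrightarrow> (\<gamma>, z + (y - y')) \<in> \<Psi>"
    \<comment> \<open>The propagation starts at a neighbour because \<open>translate\<close>
      requires an inner product of absolute value 1/2, which \<open>\<alpha>\<close> does not have
      with itself.\<close>
    obtain \<gamma>0 where \<gamma>0: "\<gamma>0 \<in> F4_short" "\<alpha> \<bullet> \<gamma>0 = 1/2" using F4_short_ex_neighbour[OF \<alpha>(1)] .
    have "?P \<gamma>0" using translate[OF \<alpha> \<gamma>0(1)] \<gamma>0(2) by simp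
    have "?P \<gamma>" if "\<gamma> \<in> F4_short" for \<gamma>
    proof (rule F4_short_connected[of \<gamma>0 ?P \<gamma>, OF \<gamma>0(1) \<open>?P \<gamma>0\<close> _ that])
      fix \<beta> \<delta> assume *: "\<beta> \<in> F4_short" "\<delta> \<in> F4_short" "?P \<beta>" "\<bar>\<beta> \<bullet> \<delta>\<bar> = 1/2"
      obtain w where w: "(\<beta>, w) \<in> \<Psi>" using short[OF *(1)] by blast
      then have w': "(\<beta>, w + (y - y')) \<in> \<Psi>" using *(3) by blast
      have "(\<delta>, z + (w + (y - y') - w)) \<in> \<Psi>" if "(\<delta>, z) \<in> \<Psi>" for z
        by (rule translate[OF *(1) w' w *(2) that *(4)])
      then show "?P \<delta>" by simp
    qed
    then show ?thesis by (simp add: K_def)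
  qed
  have K_add: "(\<alpha>, z + d) \<in> \<Psi>" if "d \<in> K" "\<alpha> \<in> F4_short" "(\<alpha>, z) \<in> \<Psi>" for \<alpha> z d
    using that by (simp add: K_def)
  obtain yh where yh: "(half_sum, yh) \<in> \<Psi>" using short[OF half_sum_short] by blast
  have K: "additive_subgroup K"
  proof (rule additive_subgroupI)
    fix x y assume "x \<in> K" "y \<in> K"
    \<comment> \<open>Elements of \<open>K\<close> are realised as differences of points over one
      root, so \<open>diff_K\<close> yields closure under differences.\<close>
    then have "(yh + x) - (yh + y) \<in> K"
      using diff_K[OF half_sum_short] K_add[OF _ half_sum_short yh] by blast
    then show "x - y \<in> K" by simp
  qed (simp add: K_def)
  have K_S: "K \<subseteq> S"
  proof
    fix x assume "x \<in> K"
    then have "(yh + x) - yh \<in> S"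
      using K_add[OF _ half_sum_short yh] mem_S yh by (intro additive_subgroup_diff[OF S]) blast+
    then show "x \<in> S" by simp
  qed

  have "\<forall>i. \<exists>y. (\<epsilon> i, y) \<in> \<Psi>" using short[OF eps_in_F4_short] by blast
  then obtain e where e: "\<And>i. (\<epsilon> i, e i) \<in> \<Psi>" using choice by meson
  \<comment> \<open>The linear map with \<open>half_sum \<mapsto> yh\<close> and \<open>\<epsilon> i \<mapsto> e i\<close> for \<open>i \<noteq> 4\<close>, since
    \<open>v = 2 v\<^sub>4 half_sum + (\<Sum>i\<noteq>4. (v\<^sub>i - v\<^sub>4) \<epsilon> i)\<close>.\<close>
  define F where "F v = (2 * v $ 4) *\<^sub>R yh + (v $ 1 - v $ 4) *\<^sub>R e 1 + (v $ 2 - v $ 4) *\<^sub>R e 2 +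
    (v $ 3 - v $ 4) *\<^sub>R e 3" for v :: "real^4"
  have F_plus: "F (v + w) = F v + F w" for v w by (simp add: F_def algebra_simps)
  have F_uminus: "F (- v) = - F v" for v by (simp add: F_def algebra_simps)
  have F_minus: "F (v - w) = F v - F w" for v w
    using F_plus[of v "- w"] F_uminus[of w] by simp
  \<comment> \<open>The generators are the roots where \<open>F\<close> has a prescribed value in
    \<open>\<Psi>\<close>. The value \<open>F (\<epsilon> 4) = 2 yh - e 1 - e 2 - e 3\<close> need
    not be \<open>e 4\<close>, so \<open>\<epsilon> 4\<close> must be reached through sums.\<close>
  have F_short: "(\<alpha>, F \<alpha>) \<in> \<Psi>" if "\<alpha> \<in> F4_short" for \<alpha>
  proof (rule F4_short_generated[where P = "\<lambda>\<alpha>. (\<alpha>, F \<alpha>) \<in> \<Psi>", OF _ _ _ _ that])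
    show "(half_sum, F half_sum) \<in> \<Psi>" using yh by (simp add: F_def)
    show "(\<epsilon> i, F (\<epsilon> i)) \<in> \<Psi>" if "i \<noteq> 4" for i
      using e[of i] exhaust_4[of i] that by (auto simp: F_def eps_nth)
  qed (use minus sum_short in \<open>auto simp: F_plus F_uminus\<close>)
  have F_S: "F v \<in> S" if "v \<in> F4_lattice" for v
    using that unfolding F4_lattice_def
  proof induction
    case (base s)
    then show ?case
      using mem_S[OF F_short] additive_subgroup_zero[OF S] by (auto simp: F_def)
  qed (simp add: F_minus additive_subgroup_diff[OF S])

  have "fst ` \<Psi> \<noteq> F4" using semi by (auto simp: semi_closed_def sum_closed_in_def)
  moreover have "fst ` \<Psi> \<subseteq> F4" using semi by (simp add: semi_closed_def)
  \<comment> \<open>The gradient is not closed, hence not all of \<open>F4\<close>; it contains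
    every short root, so a missing root is long.\<close>
  ultimately obtain \<beta>0 where \<beta>0: "\<beta>0 \<in> F4_long" "\<beta>0 \<notin> fst ` \<Psi>"
    using maximal_semi_closed_imp_short[OF max semi] by (auto simp: F4_def)
  let ?B = "{x + y | x y. x \<in> K \<and> y \<in> L}"
  have B: "additive_subgroup ?B" by (rule additive_subgroup_sums[OF K L])
  have L_B: "L \<subseteq> ?B" using additive_subgroup_zero[OF K] by force
  have K_B: "K \<subseteq> ?B" using additive_subgroup_zero[OF L] by force
  have B_S: "?B \<subseteq> S" using K_S L_sub additive_subgroup_add[OF S] by blast
  have double_B: "s + s \<in> ?B" if "s \<in> S" for s using double[OF that] L_B by blast
  \<comment> \<open>If \<open>F \<beta>0 = k + l\<close>, shifting the point over one short summand
    by \<open>- k\<close> makes the sum equal to \<open>l \<in> L\<close>, and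
    \<open>\<beta>0\<close> would belong to the gradient.\<close>
  have F_B: "F \<beta>0 \<notin> ?B"
  proof
    assume "F \<beta>0 \<in> ?B"
    then obtain k l where kl: "k \<in> K" "l \<in> L" "F \<beta>0 = k + l" by blast
    obtain \<alpha> \<gamma> where \<alpha>: "\<alpha> \<in> F4_short" "\<gamma> \<in> F4_short" "\<beta>0 = \<alpha> + \<gamma>"
      using F4_long_eq_sum[OF \<beta>0(1)] .
    have "(\<gamma>, F \<gamma> + - k) \<in> \<Psi>"
      using K_add[OF additive_subgroup_minus[OF K kl(1)] \<alpha>(2) F_short[OF \<alpha>(2)]] .
    moreover have "F \<alpha> + (F \<gamma> + - k) = l" using kl(3) \<alpha>(3) by (simp add: F_plus algebra_simps)
    ultimately have "(\<beta>0, l) \<in> \<Psi>"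
      using sum[OF F_short[OF \<alpha>(1)], of "(\<gamma>, F \<gamma> + - k)"] \<alpha>(3) kl(2) \<beta>0(1) roots_long by simp
    then show False using \<beta>0(2) by force
  qed
  have "\<exists>H. additive_subgroup H \<and> ?B \<subseteq> H \<and> H \<subseteq> S \<and> F \<beta>0 \<notin> H \<and>
      (\<forall>y\<in>S. y \<notin> H \<longrightarrow> y - F \<beta>0 \<in> H)"
    by (rule ex_index_two_avoiding[OF S B B_S _ F_S[OF F4_long_lattice[OF \<beta>0(1)]] F_B])
      (rule double_B)
  then obtain H where H': "additive_subgroup H" "?B \<subseteq> H" "H \<subseteq> S" "F \<beta>0 \<notin> H"
    and index: "\<forall>y\<in>S. y \<notin> H \<longrightarrow> y - F \<beta>0 \<in> H"
    by (elim exE conjE) (rule that)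
  interpret F4_nontrivial_twist S L H F \<beta>0
    by unfold_locales
      (use H' L_B \<beta>0 in \<open>auto simp: F_S F_plus additive_subgroup_zero\<close>)
  have "\<Psi> \<subseteq> twisted"
  proof
    fix a assume a: "a \<in> \<Psi>"
    obtain \<beta> y where ab: "a = (\<beta>, y)" by (cases a)
    have mem: "(\<beta>, y) \<in> \<Psi>" "(\<beta>, y) \<in> roots" using a sub ab by auto
    show "a \<in> twisted"
    proof (cases "\<beta> \<in> F4_short")
      case True
      then have "y - F \<beta> \<in> H" using diff_K[OF True mem(1) F_short[OF True]] K_B H'(2) by blast
      then show ?thesis using True ab by (simp add: twisted_short)
    next
      case False
      then have \<beta>: "\<beta> \<in> F4_long" "y \<in> L" using mem(2) by (auto simp: roots_def)
      obtain \<alpha> \<gamma> where \<alpha>: "\<alpha> \<in> F4_short" "\<gamma> \<in> F4_short" "\<beta> = \<alpha> + \<gamma>"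
        using F4_long_eq_sum[OF \<beta>(1)] .
      \<comment> \<open>Comparing this point with \<open>F \<gamma>\<close> in the same fibre shows
        \<open>y - F \<beta> \<in> K\<close>; as \<open>y \<in> L\<close>, both parts of
        \<open>K + L\<close> push \<open>F \<beta>\<close> into \<open>H\<close>.\<close>
      have "(\<gamma>, y - F \<alpha>) \<in> \<Psi>"
        using sum_short[OF mem(1) minus[OF F_short[OF \<alpha>(1)]]] \<alpha> by simp
      from diff_K[OF \<alpha>(2) this F_short[OF \<alpha>(2)]] have "y - F \<alpha> - F \<gamma> \<in> H"
        using K_B H'(2) by blast
      moreover have "y \<in> H" using \<beta>(2) L_B H'(2) by blast
      ultimately have "y - (y - F \<alpha> - F \<gamma>) \<in> H" by (rule additive_subgroup_diff[OF H'(1), rotated])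
      then have "F \<beta> \<in> H" by (simp add: \<alpha>(3) F_plus add.commute)
      then show ?thesis using \<beta> ab by (simp add: twisted_long)
    qed
  qed
  then have "\<Psi> = twisted"
    using max closed_subroot_system_twisted
    unfolding maximal_closed_subroot_system_def closed_subroot_system_def subroot_system_def
    by blast
  moreover have "y - x \<in> H" if "x \<in> S" "x \<notin> H" "y \<in> S" "y \<notin> H" for x y
    using additive_subgroup_diff[OF H'(1) index[rule_format, OF that(3,4)] index[rule_format, OF that(1,2)]] by simp
  ultimately show thesis
    using that F4_nontrivial_twist_axioms by blast
qed

end

section \<open>Translation between twists and the data H, I, \<tau>\<close>

context F4_twist
begin

text \<open>Doubles of elements of \<open>S\<close> lie in \<open>L \<subseteq> H\<close>, so signs
  do not matter modulo \<open>H\<close>.\<close>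

lemma F_signed_eps_sum_iff:
  assumes "c \<in> {1, -1}" "d \<in> {1, -1}"
  shows "F (c *\<^sub>R \<epsilon> i + d *\<^sub>R \<epsilon> j) \<in> H \<longleftrightarrow> F (\<epsilon> i) - F (\<epsilon> j) \<in> H"
proof -
  have lat: "\<epsilon> k \<in> F4_lattice" for k by (rule F4_short_lattice[OF eps_in_F4_short])
  have lat': "b *\<^sub>R \<epsilon> k \<in> F4_lattice" if "b \<in> {1, -1}" for b k
    using lat[of k] additive_subgroup_minus[OF F4_lattice_subgroup lat[of k]] that by auto
  have pos: "F (b *\<^sub>R \<epsilon> k) - F (\<epsilon> k) \<in> H" if "b \<in> {1, -1}" for b k
  proof (cases "b = 1")
    case False
    then have "b = -1" using that by simp
    then show ?thesis
      using additive_subgroup_diff[OF H F_minus[OF lat[of k]] double_mem[OF F_mem[OF lat[of k]]]]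
      by simp
  qed (simp add: additive_subgroup_zero[OF H])
  have neg: "F (d *\<^sub>R \<epsilon> j) + F (\<epsilon> j) \<in> H"
    using additive_subgroup_add[OF H pos[OF assms(2), of j] double_mem[OF F_mem[OF lat[of j]]]]
    by simp
  have "F (c *\<^sub>R \<epsilon> i + d *\<^sub>R \<epsilon> j) - (F (c *\<^sub>R \<epsilon> i) + F (d *\<^sub>R \<epsilon> j)) \<in> H"
    by (rule F_add) (use lat' assms in auto)
  from additive_subgroup_add[OF H this additive_subgroup_add[OF H pos[OF assms(1), of i] neg]]
  have *: "F (c *\<^sub>R \<epsilon> i + d *\<^sub>R \<epsilon> j) - (F (\<epsilon> i) - F (\<epsilon> j)) \<in> H" by (simp add: algebra_simps)
  show ?thesis
    using additive_subgroup_add_iff[OF H *, of "F (\<epsilon> i) - F (\<epsilon> j)"] by simp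
qed

lemma twisted_eq:
  assumes \<tau>: "\<And>\<alpha>. \<alpha> \<in> F4_short \<Longrightarrow> \<tau> \<alpha> = {y. y - F \<alpha> \<in> H}"
    and I: "\<And>i j. i \<in> I \<and> j \<in> I \<or> i \<notin> I \<and> j \<notin> I \<longleftrightarrow> F (\<epsilon> i) - F (\<epsilon> j) \<in> H"
  shows "twisted = (\<Union>\<alpha>\<in>F4_short. {\<alpha>} \<times> \<tau> \<alpha>) \<union>
           (\<Union>\<beta>\<in>{c *\<^sub>R \<epsilon> i + d *\<^sub>R \<epsilon> j | c d i j. c \<in> {1, -1} \<and> d \<in> {1, -1} \<and> i \<noteq> j \<and>
               (i \<in> I \<and> j \<in> I \<or> i \<notin> I \<and> j \<notin> I)}. {\<beta>} \<times> L)"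
proof -
  have "{c *\<^sub>R \<epsilon> i + d *\<^sub>R \<epsilon> j | c d i j. c \<in> {1, -1} \<and> d \<in> {1, -1} \<and> i \<noteq> j \<and>
      (i \<in> I \<and> j \<in> I \<or> i \<notin> I \<and> j \<notin> I)} = {\<beta> \<in> F4_long. F \<beta> \<in> H}" (is "?A = ?B")
  proof
    show "?A \<subseteq> ?B"
    proof
      fix \<beta> assume "\<beta> \<in> ?A"
      then obtain c d i j where *: "c \<in> {1, -1}" "d \<in> {1, -1}" "i \<noteq> j"
        "i \<in> I \<and> j \<in> I \<or> i \<notin> I \<and> j \<notin> I" "\<beta> = c *\<^sub>R \<epsilon> i + d *\<^sub>R \<epsilon> j" by blast
      then show "\<beta> \<in> ?B"
        using F4_longI[OF *(1-3,5)] F_signed_eps_sum_iff[OF *(1,2), of i j] I[of i j] by simp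
    qed
    show "?B \<subseteq> ?A"
    proof
      fix \<beta> assume \<beta>: "\<beta> \<in> ?B"
      then obtain c d i j where *: "c \<in> {1, -1}" "d \<in> {1, -1}" "i \<noteq> j" "\<beta> = c *\<^sub>R \<epsilon> i + d *\<^sub>R \<epsilon> j"
        unfolding F4_long_def by blast
      then have "i \<in> I \<and> j \<in> I \<or> i \<notin> I \<and> j \<notin> I"
        using \<beta> F_signed_eps_sum_iff[OF *(1,2), of i j] I[of i j] by simp
      then show "\<beta> \<in> ?A" using * by blast
    qed
  qed
  then show ?thesis using \<tau> by (auto simp: twisted_def)
qed

end

text \<open>The parity condition says that \<open>I\<close> has an even number of elements, and it
  is neither empty nor everything.\<close>

lemma card_two_signs:
  fixes I :: "4 set"
  assumes parity: "((1 \<in> I \<longleftrightarrow> 2 \<in> I) \<longleftrightarrow> (3 \<in> I \<longleftrightarrow> 4 \<in> I))" and "i \<in> I" "j \<notin> I"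
  shows "card I = 2"
proof -
  have "card I = (\<Sum>i\<in>UNIV. if i \<in> I then 1 else 0)"
    by (simp add: sum.If_cases)
  also have "\<dots> = (if 1 \<in> I then 1 else 0) + (if 2 \<in> I then 1 else 0) +
      (if 3 \<in> I then 1 else 0) + (if 4 \<in> I then 1 else 0)"
    by (simp add: sum_4)
  also have "\<dots> = 2"
    using parity assms(2,3) exhaust_4[of i] exhaust_4[of j] by auto
  finally show ?thesis .
qed

text \<open>\<open>I\<close> collects the indices at which \<tau> is nonzero. Since the
  \<open>\<epsilon> i\<close> add up to \<open>half_sum + half_sum\<close>, their values sum to zero
  in \<open>S / H\<close>, so an even number of them is nonzero; \<open>\<beta>0\<close> excludes
  none and all four.\<close>

lemma (in F4_nontrivial_twist) twisted_data:
  assumes index: "\<And>x y. x \<in> S \<Longrightarrow> x \<notin> H \<Longrightarrow> y \<in> S \<Longrightarrow> y \<notin> H \<Longrightarrow> y - x \<in> H"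
  defines "\<tau> \<equiv> \<lambda>v. {y. y - F v \<in> H}" and "I \<equiv> {i. F (\<epsilon> i) \<notin> H}"
  shows "maximal_subgroup H (additive_grp S)" "subgroup_index (additive_grp S) H = 2" "card I = 2"
    "Z_linear F4_short (additive_grp S Mod H) \<tau>"
    "\<And>i j. i \<in> I \<and> j \<in> I \<or> i \<notin> I \<and> j \<notin> I \<longleftrightarrow> F (\<epsilon> i) - F (\<epsilon> j) \<in> H"
proof -
  have \<beta>0_S: "F \<beta>0 \<in> S" by (rule F_mem[OF F4_long_lattice[OF \<beta>0(1)]])
  have eps_S: "F (\<epsilon> i) \<in> S" for i by (rule F_mem[OF F4_short_lattice[OF eps_in_F4_short]])
  have diff: "x - y \<in> H \<longleftrightarrow> (x \<in> H \<longleftrightarrow> y \<in> H)" if "x \<in> S" "y \<in> S" for x y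
    using index[OF that(2) _ that(1)] additive_subgroup_diff[OF H, of x y]
      additive_subgroup_add_iff[OF H, of "x - y" y] by auto
  have plus: "x + y \<in> H \<longleftrightarrow> (x \<in> H \<longleftrightarrow> y \<in> H)" if "x \<in> S" "y \<in> S" for x y
    using diff[OF that(1) additive_subgroup_minus[OF S that(2)]]
      additive_subgroup_minus[OF H, of y] additive_subgroup_minus[OF H, of "- y"] by auto
  show "maximal_subgroup H (additive_grp S)" "subgroup_index (additive_grp S) H = 2"
    by (rule index_twoI[OF S H H_sub \<beta>0_S \<beta>0(2)], rule index[OF \<beta>0_S \<beta>0(2)], assumption+)+
  show eq: "i \<in> I \<and> j \<in> I \<or> i \<notin> I \<and> j \<notin> I \<longleftrightarrow> F (\<epsilon> i) - F (\<epsilon> j) \<in> H" for i j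
    using diff[OF eps_S eps_S, of i j] by (auto simp: I_def)
  show "card I = 2"
  proof -
    obtain c d i j where *: "c \<in> {1, -1}" "d \<in> {1, -1}" "\<beta>0 = c *\<^sub>R \<epsilon> i + d *\<^sub>R \<epsilon> j"
      using \<beta>0(1) unfolding F4_long_def by blast
    have "\<not> (i \<in> I \<and> j \<in> I \<or> i \<notin> I \<and> j \<notin> I)"
      unfolding eq using \<beta>0(2) F_signed_eps_sum_iff[OF *(1,2), of i j] *(3) by simp
    then have ij: "\<exists>i j. i \<in> I \<and> j \<notin> I" by blast
    let ?s = "\<epsilon> 1 + \<epsilon> 2 + (\<epsilon> 3 + \<epsilon> 4)"
    have lat: "\<epsilon> i \<in> F4_lattice" "\<epsilon> i + \<epsilon> j \<in> F4_lattice" "half_sum \<in> F4_lattice" for i j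
      by (simp_all add: F4_short_lattice eps_in_F4_short half_sum_short
          additive_subgroup_add[OF F4_lattice_subgroup])
    have "?s = half_sum + half_sum" by (simp add: vec_eq_iff forall_4 eps_nth)
    then have "F ?s - (F half_sum + F half_sum) \<in> H" using F_add[OF lat(3,3)] by simp
    from additive_subgroup_add[OF H this double_mem[OF F_mem[OF lat(3)]]]
    have s: "F ?s \<in> H" by simp
    let ?f = "F (\<epsilon> 1) + F (\<epsilon> 2) + (F (\<epsilon> 3) + F (\<epsilon> 4))"
    have "F ?s - (F (\<epsilon> 1 + \<epsilon> 2) + F (\<epsilon> 3 + \<epsilon> 4)) \<in> H" by (rule F_add[OF lat(2,2)])
    from additive_subgroup_add[OF H additive_subgroup_add[OF H this F_add[OF lat(1,1), of 1 2]]
        F_add[OF lat(1,1), of 3 4]]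
    have "F ?s - ?f \<in> H" by (simp add: algebra_simps)
    from additive_subgroup_diff[OF H s this] have "?f \<in> H" by (simp add: algebra_simps)
    then have "(F (\<epsilon> 1) \<in> H \<longleftrightarrow> F (\<epsilon> 2) \<in> H) \<longleftrightarrow> (F (\<epsilon> 3) \<in> H \<longleftrightarrow> F (\<epsilon> 4) \<in> H)"
      by (simp add: plus eps_S additive_subgroup_add[OF S])
    then show ?thesis using card_two_signs[of I] ij unfolding I_def by auto
  qed
  have "\<tau> \<in> hom (additive_grp (group_closure F4_short)) (additive_grp S Mod H)"
  proof (rule homI)
    fix v assume "v \<in> carrier (additive_grp (group_closure F4_short))"
    then have v: "v \<in> F4_lattice" by (simp add: additive_grp_def F4_lattice_def)
    then show "\<tau> v \<in> carrier (additive_grp S Mod H)"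
      using F_mem by (auto simp: FactGroup_def rcosets_additive_grp[OF H] \<tau>_def)
    fix w assume "w \<in> carrier (additive_grp (group_closure F4_short))"
    then have w: "w \<in> F4_lattice" by (simp add: additive_grp_def F4_lattice_def)
    have "\<tau> (v + w) = {z. z - (F v + F w) \<in> H}"
      using F_add[OF v w] by (simp add: \<tau>_def coset_eq_iff[OF H])
    then show "\<tau> (v \<otimes>\<^bsub>additive_grp (group_closure F4_short)\<^esub> w) = \<tau> v \<otimes>\<^bsub>additive_grp S Mod H\<^esub> \<tau> w"
      using set_mult_cosets_additive_grp[OF S H H_sub F_mem[OF v] F_mem[OF w]]
      by (simp add: \<tau>_def) (simp add: additive_grp_def)
  qed
  then show "Z_linear F4_short (additive_grp S Mod H) \<tau>" by (auto simp: Z_linear_def)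
qed

text \<open>\<open>F\<close> chooses a representative in each coset. Such a choice is additive only
  modulo \<open>H\<close>, which is why \<open>F4_twist\<close> asks for no more.\<close>

lemma (in F4_pair) twist_of_Z_linear:
  assumes H: "additive_subgroup H" "L \<subseteq> H" "H \<subseteq> S"
    and \<tau>: "Z_linear F4_short (additive_grp S Mod H) \<tau>"
  obtains F where "F4_twist S L H F" "\<forall>\<alpha>\<in>F4_short. \<tau> \<alpha> = {y. y - F \<alpha> \<in> H}"
proof -
  obtain f where f: "f \<in> hom (additive_grp F4_lattice) (additive_grp S Mod H)"
    "\<And>\<alpha>. \<alpha> \<in> F4_short \<Longrightarrow> \<tau> \<alpha> = f \<alpha>"
    using \<tau> unfolding Z_linear_def F4_lattice_def by blast
  have coset: "f v \<in> rcosets\<^bsub>additive_grp S\<^esub> H" if "v \<in> F4_lattice" for v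
    using hom_in_carrier[OF f(1), of v] that by (simp add: additive_grp_def FactGroup_def)
  define F where "F v = (SOME y. y \<in> f v)" for v
  have Fv: "F v \<in> f v" if v: "v \<in> F4_lattice" for v
  proof -
    obtain s where "f v = {y. y - s \<in> H}"
      using coset[OF v] by (auto simp: rcosets_additive_grp[OF H(1)])
    then have "s \<in> f v" using additive_subgroup_zero[OF H(1)] by simp
    then show ?thesis unfolding F_def by (rule someI[of "\<lambda>y. y \<in> f v"])
  qed
  have f_eq: "F v \<in> S" "f v = {y. y - F v \<in> H}" if "v \<in> F4_lattice" for v
    using mem_rcosets_additive_grp[OF H(1,3) S coset[OF that] Fv[OF that]] .
  have "F (v + w) - (F v + F w) \<in> H" if vw: "v \<in> F4_lattice" "w \<in> F4_lattice" for v w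
  proof -
    have "f (v + w) = f v <#>\<^bsub>additive_grp S\<^esub> f w"
      using hom_mult[OF f(1), of v w] vw by (simp add: additive_grp_def FactGroup_def)
    also have "\<dots> = {z. z - (F v + F w) \<in> H}"
      using set_mult_cosets_additive_grp[OF S H(1,3) f_eq(1)[OF vw(1)] f_eq(1)[OF vw(2)]]
        f_eq(2)[OF vw(1)] f_eq(2)[OF vw(2)] by simp
    finally have "f (v + w) = {z. z - (F v + F w) \<in> H}" .
    then show ?thesis using Fv[OF additive_subgroup_add[OF F4_lattice_subgroup vw]] by blast
  qed
  then have "F4_twist S L H F" using H f_eq(1) by unfold_locales
  moreover have "\<forall>\<alpha>\<in>F4_short. \<tau> \<alpha> = {y. y - F \<alpha> \<in> H}"
    using f(2) f_eq(2)[OF F4_short_lattice] by simp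
  ultimately show thesis by (rule that)
qed

theorem theorem4:
  fixes \<Lambda> :: "real^4 \<Rightarrow> 'y::real_vector set"
    and Y :: "'y set"
    and \<Phi> \<Psi> :: "((real^4) \<times> 'y) set"
  assumes "irreducible_affine_reflection_system F4 Y \<Lambda> \<Phi>"
    and "\<Psi> \<subseteq> \<Phi>"
  shows "maximal_closed_subroot_system (real_roots F4 \<Lambda>) \<Psi> \<and>
           semi_closed F4 (gradient F4 \<Lambda> \<Psi>) \<longleftrightarrow>
         (\<exists>(H :: 'y set) (I :: 4 set) (\<tau> :: real^4 \<Rightarrow> 'y set).
            maximal_subgroup H (additive_grp (Lambda_short F4 \<Lambda>)) \<and>
            subgroup_index (additive_grp (Lambda_short F4 \<Lambda>)) H = 2 \<and>
            Lambda_long F4 \<Lambda> \<subseteq> H \<and>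
            card I = 2 \<and>
            Z_linear F4_short (additive_grp (Lambda_short F4 \<Lambda>) Mod H) \<tau> \<and>
            (\<forall>i j. (i \<in> I \<and> j \<in> I \<or> i \<notin> I \<and> j \<notin> I) \<longrightarrow> \<tau> (\<epsilon> i) = \<tau> (\<epsilon> j)) \<and>
            (\<forall>r s. r \<in> I \<and> s \<notin> I \<longrightarrow> \<tau> (\<epsilon> r) \<noteq> \<tau> (\<epsilon> s)) \<and>
            \<Psi> = (\<Union>\<alpha>\<in>F4_short. {\<alpha>} \<times> \<tau> \<alpha>) \<union>
                (\<Union>\<beta>\<in>{c *\<^sub>R \<epsilon> i + d *\<^sub>R \<epsilon> j | c d i j.
                        c \<in> {1, -1} \<and> d \<in> {1, -1} \<and> i \<noteq> j \<and>
                        (i \<in> I \<and> j \<in> I \<or> i \<notin> I \<and> j \<notin> I)}.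
                   {\<beta>} \<times> Lambda_long F4 \<Lambda>))"
    (is "?L \<longleftrightarrow> (\<exists>H I \<tau>. ?R H I \<tau>)")
proof -
  have E: "extension_datum F4 Y \<Lambda>"
    using assms(1) by (simp add: irreducible_affine_reflection_system_def)
  define S where "S = Lambda_short F4 \<Lambda>"
  define L where "L = Lambda_long F4 \<Lambda>"
  interpret F4_pair S L unfolding S_def L_def by (rule extension_datum_F4_pair[OF E])
  have rr: "real_roots F4 \<Lambda> = roots" by (rule real_roots_F4[OF E S_def L_def])
  show ?thesis
  proof
    assume l: ?L
    then have max: "maximal_closed_subroot_system roots \<Psi>" by (simp add: rr)
    then have "\<Psi> \<subseteq> roots"
      using closed_subroot_system_sub by (simp add: maximal_closed_subroot_system_def)
    then have "semi_closed F4 (fst ` \<Psi>)" using l gradient_eq_fst[of \<Psi> F4 \<Lambda>] by (simp add: rr)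
    from maximal_semi_closed_imp_twisted[OF max this] obtain H F \<beta>0 where
      tw: "F4_nontrivial_twist S L H F \<beta>0" "\<Psi> = F4_twist.twisted L H F"
        "\<And>x y. x \<in> S \<Longrightarrow> x \<notin> H \<Longrightarrow> y \<in> S \<Longrightarrow> y \<notin> H \<Longrightarrow> y - x \<in> H"
      by metis
    interpret F4_nontrivial_twist S L H F \<beta>0 by (rule tw(1))
    define \<tau> where "\<tau> v = {y. y - F v \<in> H}" for v
    define I where "I = {i. F (\<epsilon> i) \<notin> H}"
    note data = twisted_data[OF tw(3), folded \<tau>_def I_def]
    have \<tau>_eq: "\<tau> (\<epsilon> i) = \<tau> (\<epsilon> j) \<longleftrightarrow> F (\<epsilon> i) - F (\<epsilon> j) \<in> H" for i j
      unfolding \<tau>_def by (rule coset_eq_iff[OF H])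
    have eq: "\<Psi> = (\<Union>\<alpha>\<in>F4_short. {\<alpha>} \<times> \<tau> \<alpha>) \<union>
           (\<Union>\<beta>\<in>{c *\<^sub>R \<epsilon> i + d *\<^sub>R \<epsilon> j | c d i j. c \<in> {1, -1} \<and> d \<in> {1, -1} \<and> i \<noteq> j \<and>
               (i \<in> I \<and> j \<in> I \<or> i \<notin> I \<and> j \<notin> I)}. {\<beta>} \<times> L)"
      unfolding tw(2) by (rule twisted_eq[OF _ data(5)]) (simp add: \<tau>_def)
    have "\<forall>i j. (i \<in> I \<and> j \<in> I \<or> i \<notin> I \<and> j \<notin> I) \<longrightarrow> \<tau> (\<epsilon> i) = \<tau> (\<epsilon> j)"
      "\<forall>r s. r \<in> I \<and> s \<notin> I \<longrightarrow> \<tau> (\<epsilon> r) \<noteq> \<tau> (\<epsilon> s)"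
      unfolding \<tau>_eq using data(5) by blast+
    then have "?R H I \<tau>"
      unfolding S_def[symmetric] L_def[symmetric]
      by (intro conjI data(1-4) L_sub_H eq)
    then show "\<exists>H I \<tau>. ?R H I \<tau>" by (intro exI)
  next
    assume "\<exists>H I \<tau>. ?R H I \<tau>"
    then obtain H I \<tau> where R: "maximal_subgroup H (additive_grp S)"
      "subgroup_index (additive_grp S) H = 2" "L \<subseteq> H" "card I = 2"
      "Z_linear F4_short (additive_grp S Mod H) \<tau>"
      and I: "\<forall>i j. (i \<in> I \<and> j \<in> I \<or> i \<notin> I \<and> j \<notin> I) \<longrightarrow> \<tau> (\<epsilon> i) = \<tau> (\<epsilon> j)"
        "\<forall>r s. r \<in> I \<and> s \<notin> I \<longrightarrow> \<tau> (\<epsilon> r) \<noteq> \<tau> (\<epsilon> s)"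
      and eq: "\<Psi> = (\<Union>\<alpha>\<in>F4_short. {\<alpha>} \<times> \<tau> \<alpha>) \<union>
           (\<Union>\<beta>\<in>{c *\<^sub>R \<epsilon> i + d *\<^sub>R \<epsilon> j | c d i j. c \<in> {1, -1} \<and> d \<in> {1, -1} \<and> i \<noteq> j \<and>
               (i \<in> I \<and> j \<in> I \<or> i \<notin> I \<and> j \<notin> I)}. {\<beta>} \<times> L)"
      unfolding S_def[symmetric] L_def[symmetric] by (elim exE conjE) (rule that)
    have H: "additive_subgroup H" "H \<subseteq> S"
      using R(1) by (simp_all add: maximal_subgroup_def subgroup_additive_grp_iff[OF S])
    obtain F where F: "F4_twist S L H F" "\<forall>\<alpha>\<in>F4_short. \<tau> \<alpha> = {y. y - F \<alpha> \<in> H}"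
      using twist_of_Z_linear[OF H(1) R(3) H(2) R(5)] .
    interpret F4_twist S L H F by (rule F(1))
    have \<tau>_eq: "\<tau> (\<epsilon> i) = \<tau> (\<epsilon> j) \<longleftrightarrow> F (\<epsilon> i) - F (\<epsilon> j) \<in> H" for i j
      unfolding F(2)[rule_format, OF eps_in_F4_short] by (rule coset_eq_iff[OF H(1)])
    have I_iff: "i \<in> I \<and> j \<in> I \<or> i \<notin> I \<and> j \<notin> I \<longleftrightarrow> F (\<epsilon> i) - F (\<epsilon> j) \<in> H" for i j
      unfolding \<tau>_eq[symmetric] using I by metis
    have \<Psi>: "\<Psi> = twisted" unfolding eq by (rule twisted_eq[OF F(2)[rule_format] I_iff, symmetric])
    \<comment> \<open>An index inside and one outside \<open>I\<close> give the long root
      \<open>\<epsilon> r + \<epsilon> s\<close> at which \<tau> does not vanish, which makes the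
      twist nontrivial.\<close>
    have "I \<noteq> {}" "I \<noteq> UNIV" using R(4) by auto
    then obtain r s where rs: "r \<in> I" "s \<notin> I" by blast
    then have "r \<noteq> s" by blast
    interpret F4_nontrivial_twist S L H F "1 *\<^sub>R \<epsilon> r + 1 *\<^sub>R \<epsilon> s"
    proof
      show "1 *\<^sub>R \<epsilon> r + 1 *\<^sub>R \<epsilon> s \<in> F4_long"
        using \<open>r \<noteq> s\<close> by (intro F4_longI[OF _ _ _ refl]) simp_all
      show "F (1 *\<^sub>R \<epsilon> r + 1 *\<^sub>R \<epsilon> s) \<notin> H"
        using F_signed_eps_sum_iff[of 1 1 r s] I_iff[of r s] rs by simp
    qed
    have "maximal_closed_subroot_system roots \<Psi>"
      unfolding \<Psi> by (rule maximal_twisted) (rule index_two_diff_mem[OF S H H_sub R(2)])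
    moreover have "gradient F4 \<Lambda> \<Psi> = fst ` twisted"
      using gradient_eq_fst[of \<Psi> F4 \<Lambda>] twisted_sub by (simp add: rr \<Psi>)
    ultimately show ?L using semi_closed_fst_twisted by (simp add: rr)
  qed
qed

end
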